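(* There exists $C>0$ such that for all $g\ge3$, every graph $G=(V,E)$ on $n$ vertices with girth at least $g$ and maximum degree $\Delta$, every integer $k>2\Delta$, and every partition of $V$ into disjoint blocks $V=B_1\cup B_2\cup\dots\cup B_N$ with $\mathrm{diameter}(B_i)\le g/2-3$ for all $i$, the mixing time of the block dynamics satisfies $T_{\mathrm{mix}}\le C\Delta n\log n$.
   Context: The block dynamics with blocks $B_1,\dots,B_N$ on the set of proper $k$-colorings of $G$: at each step choose a block $B_i$ uniformly at random and replace the coloring on $B_i$ by a uniformly random proper $k$-coloring of $G$ that agrees with the current coloring outside $B_i$. The mixing time is the minimum $T$ such that from any initial proper coloring the distribution after $T$ steps is within total variation distance $1/4$ of the uniform distribution on proper $k$-colorings.
   Formalization: The formal theorem assumes that G has at least one edge (Δ ≥ 1), since for Δ = 0 and k ≥ 2 the bound CΔn log n is 0 while the mixing time is positive; vertices are labelled by natural numbers. *)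

theory Defs
  imports "HOL-Probability.Probability"
begin

definition simple_graph :: "nat set \<Rightarrow> (nat \<Rightarrow> nat \<Rightarrow> bool) \<Rightarrow> bool" where
  "simple_graph V E \<longleftrightarrow> finite V \<and> (\<forall>u v. E u v \<longrightarrow> u \<in> V \<and> v \<in> V) \<and>
     (\<forall>u v. E u v \<longrightarrow> E v u) \<and> (\<forall>v. \<not> E v v)"

definition degree :: "(nat \<Rightarrow> nat \<Rightarrow> bool) \<Rightarrow> nat \<Rightarrow> nat" where
  "degree E v = card {u. E v u}"

definition max_degree :: "nat set \<Rightarrow> (nat \<Rightarrow> nat \<Rightarrow> bool) \<Rightarrow> nat" where
  "max_degree V E = Max (degree E ` V)"

definition is_cycle :: "(nat \<Rightarrow> nat \<Rightarrow> bool) \<Rightarrow> nat list \<Rightarrow> bool" where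
  "is_cycle E xs \<longleftrightarrow> length xs \<ge> 3 \<and> distinct xs \<and>
     (\<forall>i. Suc i < length xs \<longrightarrow> E (xs ! i) (xs ! Suc i)) \<and> E (last xs) (hd xs)"

definition girth :: "(nat \<Rightarrow> nat \<Rightarrow> bool) \<Rightarrow> enat" where
  "girth E = (INF xs \<in> {xs. is_cycle E xs}. enat (length xs))"

definition is_walk :: "(nat \<Rightarrow> nat \<Rightarrow> bool) \<Rightarrow> nat list \<Rightarrow> bool" where
  "is_walk E xs \<longleftrightarrow> xs \<noteq> [] \<and> (\<forall>i. Suc i < length xs \<longrightarrow> E (xs ! i) (xs ! Suc i))"

definition gdist :: "(nat \<Rightarrow> nat \<Rightarrow> bool) \<Rightarrow> nat \<Rightarrow> nat \<Rightarrow> enat" where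
  "gdist E u v = (INF xs \<in> {xs. is_walk E xs \<and> hd xs = u \<and> last xs = v}. enat (length xs - 1))"

definition diameter :: "(nat \<Rightarrow> nat \<Rightarrow> bool) \<Rightarrow> nat set \<Rightarrow> enat" where
  "diameter E B = (SUP u \<in> B. SUP v \<in> B. gdist E u v)"

definition proper_colorings :: "nat set \<Rightarrow> (nat \<Rightarrow> nat \<Rightarrow> bool) \<Rightarrow> nat \<Rightarrow> (nat \<Rightarrow> nat) set" where
  "proper_colorings V E k = {\<sigma> \<in> V \<rightarrow>\<^sub>E {..<k}. \<forall>u v. E u v \<longrightarrow> \<sigma> u \<noteq> \<sigma> v}"

definition block_partition :: "nat set \<Rightarrow> nat \<Rightarrow> (nat \<Rightarrow> nat set) \<Rightarrow> bool" where
  "block_partition V N B \<longleftrightarrow> (\<forall>i<N. B i \<noteq> {}) \<and>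
     (\<forall>i<N. \<forall>j<N. i \<noteq> j \<longrightarrow> B i \<inter> B j = {}) \<and> (\<Union>i<N. B i) = V"

definition block_step ::
  "nat set \<Rightarrow> (nat \<Rightarrow> nat \<Rightarrow> bool) \<Rightarrow> nat \<Rightarrow> nat \<Rightarrow> (nat \<Rightarrow> nat set) \<Rightarrow> (nat \<Rightarrow> nat) \<Rightarrow> (nat \<Rightarrow> nat) pmf" where
  "block_step V E k N B \<sigma> =
     bind_pmf (pmf_of_set {..<N})
       (\<lambda>i. pmf_of_set {\<tau> \<in> proper_colorings V E k. \<forall>v \<in> V - B i. \<tau> v = \<sigma> v})"

definition block_dist ::
  "nat set \<Rightarrow> (nat \<Rightarrow> nat \<Rightarrow> bool) \<Rightarrow> nat \<Rightarrow> nat \<Rightarrow> (nat \<Rightarrow> nat set) \<Rightarrow> nat \<Rightarrow> (nat \<Rightarrow> nat) \<Rightarrow> (nat \<Rightarrow> nat) pmf" where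
  "block_dist V E k N B T \<sigma>0 = ((\<lambda>p. bind_pmf p (block_step V E k N B)) ^^ T) (return_pmf \<sigma>0)"

definition tv_dist :: "'a pmf \<Rightarrow> 'a pmf \<Rightarrow> real" where
  "tv_dist p q = (SUP A. \<bar>measure_pmf.prob p A - measure_pmf.prob q A\<bar>)"

definition mixing_time ::
  "nat set \<Rightarrow> (nat \<Rightarrow> nat \<Rightarrow> bool) \<Rightarrow> nat \<Rightarrow> nat \<Rightarrow> (nat \<Rightarrow> nat set) \<Rightarrow> nat" where
  "mixing_time V E k N B = (LEAST T. \<forall>\<sigma>0 \<in> proper_colorings V E k.
      tv_dist (block_dist V E k N B T \<sigma>0) (pmf_of_set (proper_colorings V E k)) \<le> 1/4)"

end

theory Submission
  imports Defs
begin

text \<open>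
  The proof is path coupling in its dual form. Let \<open>f\<close> be a function on colorings that changes by at
  most \<open>L * w v\<close> when the color of \<open>v\<close> changes, where \<open>w v\<close> is one plus the number of neighbors of
  \<open>v\<close> outside its block. The girth condition makes every block together with one more vertex \<open>v\<close> a
  forest. When a block is resampled with two boundary conditions that differ only at \<open>v\<close>, a
  disagreement crosses each edge with probability at most \<open>1 / (k - \<Delta>)\<close>. For a vertex \<open>x\<close> of the
  block, \<open>w x\<close> plus its degree inside the block is at most \<open>\<Delta> + 1 \<le> k - \<Delta>\<close>, so by induction along
  the forest each neighbor of \<open>v\<close> in the block contributes at most \<open>L\<close> to the difference of the two
  averages of \<open>f\<close>. Summing over the blocks, one step of the dynamics reduces the bound at \<open>v\<close> from
  \<open>L * w v\<close> to \<open>L * (w v - 1 / N)\<close>, a contraction by the factor \<open>1 - 1 / (N * (\<Delta> + 1))\<close>, and the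
  mixing time bound follows.
\<close>

section \<open>Short cycles and forests\<close>

text \<open>Walks without backtracking.\<close>

fun nb_walk :: "('a \<Rightarrow> 'a \<Rightarrow> bool) \<Rightarrow> 'a list \<Rightarrow> bool" where
  "nb_walk E [] \<longleftrightarrow> False"
| "nb_walk E [x] \<longleftrightarrow> True"
| "nb_walk E [x, y] \<longleftrightarrow> E x y"
| "nb_walk E (x # y # z # zs) \<longleftrightarrow> E x y \<and> x \<noteq> z \<and> nb_walk E (y # z # zs)"

lemma nb_walk_successively: "nb_walk E xs \<Longrightarrow> successively E xs"
  by (induction E xs rule: nb_walk.induct) auto

lemma nb_walk_tl: "nb_walk E (x # xs) \<Longrightarrow> xs \<noteq> [] \<Longrightarrow> nb_walk E xs"
  by (induction E "x # xs" arbitrary: x xs rule: nb_walk.induct) auto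

lemma distinct_walk_nb:
  "xs \<noteq> [] \<Longrightarrow> distinct xs \<Longrightarrow> successively E xs \<Longrightarrow> nb_walk E xs"
  by (induction E xs rule: nb_walk.induct) auto

text \<open>Gluing the reversed first walk to the second creates a single new turn, at
  \<open>x\<close>, and the last assumption rules out backtracking there. The induction moves the
  vertices of \<open>p\<close> one by one to the front of the second walk.\<close>

lemma nb_walk_join:
  assumes "symp E" "nb_walk E (x # p)" "nb_walk E (x # q)"
    and "p = [] \<or> q = [] \<or> hd p \<noteq> hd q"
  shows "nb_walk E (rev p @ x # q)"
  using assms(2-)
proof (induction p arbitrary: x q)
  case (Cons y p)
  have "E y x"
    using Cons.prems(1) assms(1) by (cases p) (auto dest: sympD)
  then have "nb_walk E (y # x # q)"
    using Cons.prems(2,3) by (cases q) auto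
  moreover have "nb_walk E (y # p)"
    using nb_walk_tl[OF Cons.prems(1)] by simp
  moreover have "p = [] \<or> x # q = [] \<or> hd p \<noteq> hd (x # q)"
    using Cons.prems(1) by (cases p) auto
  ultimately show ?case
    using Cons.IH by simp
qed simp

text \<open>Drop vertices from the front until the rest is distinct but still contains the head
  \<open>x\<close>. The stretch from \<open>x\<close> to just before its return is the cycle. It has
  at least three vertices because there are neither loops nor backtracking, and it is strictly
  shorter because the second \<open>x\<close> is left out.\<close>

lemma nb_walk_not_distinct_cycle:
  assumes "\<And>v. \<not> E v v" "nb_walk E xs" "\<not> distinct xs"
  shows "\<exists>ys. is_cycle E ys \<and> length ys < length xs"
  using assms(2,3)
proof (induction xs)
  case (Cons x xs)
  show ?case
  proof (cases "distinct xs")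
    case False
    then show ?thesis
      using Cons nb_walk_tl[OF Cons.prems(1)] by force
  next
    case True
    with Cons.prems(2) have "x \<in> set xs" by auto
    then obtain as bs where xs: "xs = as @ x # bs"
      by (auto simp: in_set_conv_decomp)
    have suc: "successively E ((x # as) @ (x # bs))"
      using nb_walk_successively[OF Cons.prems(1)] xs by simp
    then have path: "successively E (x # as)" and close: "E (last (x # as)) x"
      unfolding successively_append_iff by auto
    have "as \<noteq> []" using close assms(1) by auto
    moreover have "as \<noteq> [y]" for y
      using Cons.prems(1) xs by auto
    ultimately have "length (x # as) \<ge> 3"
      by (cases as; cases "tl as") auto
    then have "is_cycle E (x # as)"
      unfolding is_cycle_def using path close True xs by (auto simp: successively_conv_nth)
    then show ?thesis using xs by (intro exI[of _ "x # as"]) auto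
  qed
qed simp

text \<open>Common first steps are removed until the walks part or one of them is a single vertex.
  Once they part, going back along one and forth along the other never backtracks, returns to the
  common end, and has at most \<open>length p + length q - 1\<close> vertices.\<close>

lemma two_nb_walks_cycle:
  assumes "symp E" "\<And>v. \<not> E v v"
    and "nb_walk E p" "nb_walk E q" "hd p = hd q" "last p = last q" "p \<noteq> q"
  shows "\<exists>ys. is_cycle E ys \<and> length ys + 1 < length p + length q"
  using assms(3-)
proof (induction p arbitrary: q)
  case (Cons x p')
  obtain q' where q: "q = x # q'"
    using Cons.prems by (cases q) auto
  note nd = nb_walk_not_distinct_cycle[of E, OF assms(2)]
  consider "p' = []" | "q' = []" | "p' \<noteq> []" "q' \<noteq> []" "hd p' = hd q'"
    | "p' \<noteq> []" "q' \<noteq> []" "hd p' \<noteq> hd q'" by blast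
  then show ?case
  proof cases
    case 1
    then have "\<not> distinct q" using Cons.prems q by (cases q' rule: rev_cases) auto
    then show ?thesis using nd[OF Cons.prems(2)] 1 q by auto
  next
    case 2
    then have "\<not> distinct (x # p')"
      using Cons.prems q by (cases p' rule: rev_cases) auto
    then show ?thesis using nd[OF Cons.prems(1)] 2 q by auto
  next
    case 3
    then have "\<exists>ys. is_cycle E ys \<and> length ys + 1 < length p' + length q'"
      using Cons.prems q nb_walk_tl by (intro Cons.IH) auto
    then show ?thesis using q by auto
  next
    case 4
    have "nb_walk E (rev p' @ x # q')"
      using nb_walk_join[OF assms(1)] Cons.prems q 4 by blast
    moreover have "last p' \<in> set (rev p') \<inter> set (x # q')"
      using 4 Cons.prems(4) q last_in_set[of p'] last_in_set[of q'] by auto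
    then have "\<not> distinct (rev p' @ x # q')" by auto
    ultimately have "\<exists>ys. is_cycle E ys \<and> length ys < length (rev p' @ x # q')"
      by (rule nd)
    then show ?thesis using q by auto
  qed
qed simp

section \<open>Absence of cycles in sets of small diameter\<close>

lemma walk_to_distinct_walk:
  assumes "xs \<noteq> []" "successively E xs"
  shows "\<exists>ys. ys \<noteq> [] \<and> successively E ys \<and> distinct ys \<and> hd ys = hd xs \<and> last ys = last xs \<and>
           set ys \<subseteq> set xs \<and> length ys \<le> length xs"
  using assms
proof (induction "length xs" arbitrary: xs rule: less_induct)
  case less
  show ?case
  proof (cases "distinct xs")
    case False
    then obtain as bs cs y where xs: "xs = as @ [y] @ bs @ [y] @ cs"
      using not_distinct_decomp by blast
    let ?zs = "as @ [y] @ cs"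
    have "\<exists>ys. ys \<noteq> [] \<and> successively E ys \<and> distinct ys \<and> hd ys = hd ?zs \<and> last ys = last ?zs \<and>
           set ys \<subseteq> set ?zs \<and> length ys \<le> length ?zs"
      using less.prems xs by (intro less.hyps) (auto simp: successively_append_iff successively_Cons)
    moreover have "hd ?zs = hd xs" "last ?zs = last xs" "set ?zs \<subseteq> set xs" "length ?zs \<le> length xs"
      using xs by (auto simp: hd_append)
    ultimately show ?thesis by (metis order_trans)
  qed (use less.prems in blast)
qed

text \<open>The walks supplied by \<open>close\<close> may leave \<open>W\<close>, since distances
  are measured in the whole graph. Cycles are so long that such a short walk, made distinct, is the
  only walk without backtracking it can be compared with.\<close>

lemma nb_walk_length_le_diameter:
  assumes "symp E" "\<And>v. \<not> E v v"
    and short: "\<And>ys. is_cycle E ys \<Longrightarrow> length ys > 2 * D + 1"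
    and close: "\<And>a b. a \<in> W \<Longrightarrow> b \<in> W \<Longrightarrow>
          \<exists>xs. xs \<noteq> [] \<and> successively E xs \<and> hd xs = a \<and> last xs = b \<and> length xs \<le> D + 1"
    and "nb_walk E xs" "set xs \<subseteq> W"
  shows "length xs \<le> D + 1"
  using assms(5,6)
proof (induction xs)
  case (Cons x xs)
  show ?case
  proof (cases "xs = []")
    case False
    then have len: "length xs \<le> D + 1"
      using Cons nb_walk_tl[OF Cons.prems(1)] by auto
    obtain ys where ys: "ys \<noteq> []" "successively E ys" "hd ys = x" "last ys = last xs" "length ys \<le> D + 1"
      using close[of x "last xs"] Cons.prems(2) False last_in_set[OF False] by (metis list.set_intros(1) set_subset_Cons subsetD)
    obtain zs where zs: "zs \<noteq> []" "successively E zs" "distinct zs" "hd zs = x" "last zs = last xs"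
        "length zs \<le> D + 1"
      using walk_to_distinct_walk[OF ys(1,2)] ys by (metis order_trans)
    \<comment> \<open>By induction \<open>x # xs\<close> has at most \<open>D + 2\<close> vertices,
      and \<open>zs\<close> has at most \<open>D + 1\<close>. If they differed, there would be a
      cycle with at most \<open>2 * D + 1\<close> vertices.\<close>
    have "zs = x # xs"
    proof (rule ccontr)
      assume "zs \<noteq> x # xs"
      then have "\<exists>ys. is_cycle E ys \<and> length ys + 1 < length zs + length (x # xs)"
        using False zs Cons.prems(1) distinct_walk_nb[OF zs(1,3,2)]
        by (intro two_nb_walks_cycle[OF assms(1,2)]) auto
      then show False using short zs(6) len by fastforce
    qed
    then show ?thesis using zs by simp
  qed simp
qed simp

lemma no_cycle_in_small_diameter_set:
  assumes "symp E" "\<And>v. \<not> E v v"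
    and short: "\<And>ys. is_cycle E ys \<Longrightarrow> length ys > 2 * D + 1"
    and close: "\<And>a b. a \<in> W \<Longrightarrow> b \<in> W \<Longrightarrow>
          \<exists>xs. xs \<noteq> [] \<and> successively E xs \<and> hd xs = a \<and> last xs = b \<and> length xs \<le> D + 1"
    and "set xs \<subseteq> W"
  shows "\<not> is_cycle E xs"
proof
  assume c: "is_cycle E xs"
  then have "nb_walk E xs"
    by (intro distinct_walk_nb) (auto simp: is_cycle_def successively_conv_nth)
  then have "length xs \<le> D + 1"
    using nb_walk_length_le_diameter[of E D W xs] assms by blast
  then show False using short[OF c] by simp
qed

text \<open>A derivation of \<open>tree_attached E v S\<close> records how a change of color at \<open>v\<close> can spread into
  the forest \<open>S\<close>.\<close>

inductive tree_attached :: "('a \<Rightarrow> 'a \<Rightarrow> bool) \<Rightarrow> 'a \<Rightarrow> 'a set \<Rightarrow> bool" for E where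
  isolated: "(\<And>x. x \<in> S \<Longrightarrow> \<not> E v x) \<Longrightarrow> tree_attached E v S"
| union: "tree_attached E v C \<Longrightarrow> tree_attached E v D \<Longrightarrow> C \<inter> D = {} \<Longrightarrow>
    (\<And>x y. x \<in> C \<Longrightarrow> y \<in> D \<Longrightarrow> \<not> E x y) \<Longrightarrow> tree_attached E v (C \<union> D)"
| root: "tree_attached E u S \<Longrightarrow> E v u \<Longrightarrow> u \<notin> S \<Longrightarrow>
    (\<And>x. x \<in> S \<Longrightarrow> \<not> E v x) \<Longrightarrow> tree_attached E v (insert u S)"

text \<open>Induction on the size of \<open>S\<close>: either \<open>S\<close> splits into two sets
  without edges between them, or it is connected and its unique neighbor of \<open>v\<close> becomes
  the next root.\<close>

lemma acyclic_imp_tree_attached: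
  assumes "symp E" "finite S" "v \<notin> S"
    and "\<And>xs. set xs \<subseteq> insert v S \<Longrightarrow> \<not> is_cycle E xs"
  shows "tree_attached E v S"
  using assms(2-)
proof (induction "card S" arbitrary: S v rule: less_induct)
  case less
  show ?case
  proof (cases "\<exists>u\<in>S. E v u")
    case False
    then show ?thesis by (intro tree_attached.isolated) auto
  next
    case True
    then obtain u where u: "u \<in> S" "E v u" by blast
    \<comment> \<open>The connected component of \<open>u\<close> in the graph induced on
      \<open>S\<close>.\<close>
    define C where "C = {y. \<exists>xs. xs \<noteq> [] \<and> successively E xs \<and> hd xs = u \<and> last xs = y \<and> set xs \<subseteq> S}"
    have "C \<subseteq> S" unfolding C_def by auto
    have "u \<in> C" unfolding C_def using u by (auto intro!: exI[of _ "[u]"])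
    have closed: "\<not> E x y" if "x \<in> C" "y \<in> S - C" for x y
    proof
      assume "E x y"
      from that(1) obtain xs where xs: "xs \<noteq> []" "successively E xs" "hd xs = u" "last xs = x" "set xs \<subseteq> S"
        unfolding C_def by auto
      then have "y \<in> C"
        unfolding C_def using that(2) \<open>E x y\<close>
        by (auto simp: successively_append_iff intro!: exI[of _ "xs @ [y]"])
      with that(2) show False by simp
    qed
    show ?thesis
    proof (cases "C = S")
      case False
      have "tree_attached E v C" "tree_attached E v (S - C)"
        using less.prems \<open>C \<subseteq> S\<close> False \<open>u \<in> C\<close>
        by (intro less.hyps psubset_card_mono; auto intro: finite_subset)+
      then have "tree_attached E v (C \<union> (S - C))"
        using closed by (intro tree_attached.union) auto
      then show ?thesis using \<open>C \<subseteq> S\<close> by (simp add: Un_absorb1)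
    next
      case True
      \<comment> \<open>Here \<open>S\<close> is connected, so a path inside \<open>S\<close> from
        \<open>u\<close> to a second neighbor of \<open>v\<close> would be closed to a cycle by
        \<open>v\<close>.\<close>
      have only: "\<not> E v x" if x: "x \<in> S - {u}" for x
      proof
        assume "E v x"
        obtain xs where "xs \<noteq> []" "successively E xs" "hd xs = u" "last xs = x" "set xs \<subseteq> S"
          using x True unfolding C_def by blast
        then obtain ys where ys: "ys \<noteq> []" "successively E ys" "distinct ys" "hd ys = u" "last ys = x"
            "set ys \<subseteq> S"
          using walk_to_distinct_walk[of xs E] by (metis order_trans)
        have "length ys \<noteq> 1" using ys x by (auto simp: length_Suc_conv)
        then have "length (v # ys) \<ge> 3" using ys(1) by (cases ys; cases "tl ys") auto
        moreover have "successively E (v # ys)" using ys u by (auto simp: successively_Cons)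
        moreover have "E x v" using \<open>E v x\<close> assms(1) by (auto dest: sympD)
        ultimately have "is_cycle E (v # ys)"
          unfolding is_cycle_def using ys less.prems(2) by (auto simp: successively_conv_nth)
        then show False using less.prems(3)[of "v # ys"] ys by auto
      qed
      have "tree_attached E u (S - {u})"
        using less.prems u by (intro less.hyps card_Diff1_less) (auto simp: insert_absorb)
      then have "tree_attached E v (insert u (S - {u}))"
        using u only by (intro tree_attached.root) auto
      then show ?thesis using u by (simp add: insert_absorb)
    qed
  qed
qed

section \<open>Influence of a boundary vertex on a forest\<close>

text \<open>In the application \<open>a\<close> ranges over colors of a vertex, and a neighbor
  forbids first \<open>c\<close> and then \<open>c'\<close>. Each mean is the mean over
  \<open>A - {c, c'}\<close> mixed with a single further point, \<open>c'\<close> or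
  \<open>c\<close>, whose mass is at most \<open>1 / m\<close>.\<close>

lemma weighted_mean_remove_point_diff:
  fixes q h :: "'a \<Rightarrow> real"
  assumes "finite A" "\<And>a. a \<in> A \<Longrightarrow> q a \<ge> 0" "c \<noteq> c'"
    and pos: "sum q (A - {c}) > 0" "sum q (A - {c'}) > 0"
    and small: "c' \<in> A \<Longrightarrow> m * q c' \<le> sum q (A - {c})" "c \<in> A \<Longrightarrow> m * q c \<le> sum q (A - {c'})"
    and m: "m > 1" and diff: "\<And>a b. \<bar>h a - h b\<bar> \<le> M"
  shows "\<bar>(\<Sum>a\<in>A - {c}. q a * h a) / sum q (A - {c}) -
          (\<Sum>a\<in>A - {c'}. q a * h a) / sum q (A - {c'})\<bar> \<le> M / m"
proof -
  define A0 where "A0 = A - {c, c'}"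
  define Q where "Q = sum q A0"
  define G where "G = (\<Sum>a\<in>A0. q a * h a)"
  define r where "r = (if c \<in> A then q c else 0)"
  define r' where "r' = (if c' \<in> A then q c' else 0)"
  have fin: "finite A0" using assms(1) by (simp add: A0_def)
  have ins: "A - {c} = (if c' \<in> A then insert c' A0 else A0)" "A - {c'} = (if c \<in> A then insert c A0 else A0)"
    using \<open>c \<noteq> c'\<close> by (auto simp: A0_def)
  have nin: "c \<notin> A0" "c' \<notin> A0" by (auto simp: A0_def)
  have sums: "sum q (A - {c}) = Q + r'" "sum q (A - {c'}) = Q + r"
    "(\<Sum>a\<in>A - {c}. q a * h a) = G + r' * h c'" "(\<Sum>a\<in>A - {c'}. q a * h a) = G + r * h c"
    using fin nin by (auto simp: ins Q_def G_def r_def r'_def)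
  have r0: "r \<ge> 0" "r' \<ge> 0" using assms(2) by (auto simp: r_def r'_def)
  have Q0: "Q \<ge> 0" unfolding Q_def A0_def using assms(2) by (auto intro: sum_nonneg)
  have sm: "m * r' \<le> Q + r'" "m * r \<le> Q + r"
    using small sums pos by (auto simp: r_def r'_def)
  \<comment> \<open>Otherwise the whole mass of \<open>A - {c}\<close> would sit at
    \<open>c'\<close>, against the bound \<open>1 / m < 1\<close> on its share.\<close>
  have "Q > 0"
  proof (rule ccontr)
    assume "\<not> Q > 0"
    then have "Q = 0" using Q0 by simp
    then have "m * r' \<le> 1 * r'" "r' > 0" using sm pos sums by auto
    then show False using m by (simp add: mult_le_cancel_right)
  qed
  have hbar: "\<bar>h b - G / Q\<bar> \<le> M" for b
  proof -
    have "h b - G / Q = (\<Sum>a\<in>A0. q a * (h b - h a)) / Q"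
      using \<open>Q > 0\<close>
      by (simp add: field_simps Q_def G_def sum_subtractf sum_distrib_left sum_distrib_right)
    moreover have "\<bar>\<Sum>a\<in>A0. q a * (h b - h a)\<bar> \<le> (\<Sum>a\<in>A0. q a * M)"
      using assms(2) diff
      by (intro order_trans[OF sum_abs] sum_mono) (auto simp: abs_mult A0_def intro!: mult_mono)
    then have "\<bar>\<Sum>a\<in>A0. q a * (h b - h a)\<bar> \<le> Q * M"
      by (simp add: Q_def sum_distrib_right)
    ultimately show ?thesis using \<open>Q > 0\<close> by (simp add: abs_divide field_simps)
  qed
  have M0: "M \<ge> 0" using hbar[of c] by linarith
  define p where "p = r / (Q + r)"
  define p' where "p' = r' / (Q + r')"
  have p0: "p \<ge> 0" "p' \<ge> 0" using r0 \<open>Q > 0\<close> by (auto simp: p_def p'_def)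
  have pm: "p \<le> 1 / m" "p' \<le> 1 / m"
    using sm m r0 \<open>Q > 0\<close> by (auto simp: p_def p'_def field_simps)
  have conv: "(G + r' * h c') / (Q + r') = G / Q + p' * (h c' - G / Q)"
    "(G + r * h c) / (Q + r) = G / Q + p * (h c - G / Q)"
    using r0 \<open>Q > 0\<close> by (simp_all add: p_def p'_def divide_simps add_nonneg_eq_0_iff) (simp_all add: algebra_simps)
  \<comment> \<open>Splitting off the common mass \<open>y\<close> makes the total coefficient
    \<open>x\<close> rather than \<open>x + y\<close>. This gives \<open>M / m\<close> where the
    triangle inequality alone would give twice as much.\<close>
  have key: "\<bar>x * s - y * t\<bar> \<le> M / m"
    if "0 \<le> y" "y \<le> x" "x \<le> 1 / m" "\<bar>s\<bar> \<le> M" "\<bar>s - t\<bar> \<le> M" for x y s t :: real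
  proof -
    have "x * s - y * t = (x - y) * s + y * (s - t)" by (simp add: algebra_simps)
    also have "\<bar>\<dots>\<bar> \<le> (x - y) * M + y * M"
      using that by (intro order_trans[OF abs_triangle_ineq] add_mono) (auto simp: abs_mult intro!: mult_left_mono)
    also have "\<dots> = x * M" by (simp add: algebra_simps)
    also have "\<dots> \<le> 1 / m * M" using that M0 by (intro mult_right_mono) auto
    finally show ?thesis by simp
  qed
  have "\<bar>p' * (h c' - G / Q) - p * (h c - G / Q)\<bar> \<le> M / m"
  proof (cases "p \<le> p'")
    case True
    then show ?thesis using p0 pm hbar diff[of c' c] by (intro key) auto
  next
    case False
    then have "\<bar>p * (h c - G / Q) - p' * (h c' - G / Q)\<bar> \<le> M / m"
      using p0 pm hbar diff[of c c'] by (intro key) auto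
    then show ?thesis by (simp add: abs_minus_commute)
  qed
  then show ?thesis unfolding sums conv by simp
qed

text \<open>A Lipschitz bound in the single coordinate \<open>x\<close>. It is asked of all
  functions and all values, so that bounds can be chained through improper colorings.\<close>

definition osc_le :: "(('a \<Rightarrow> 'b) \<Rightarrow> real) \<Rightarrow> 'a \<Rightarrow> real \<Rightarrow> bool" where
  "osc_le f x W \<longleftrightarrow> (\<forall>\<tau> c. \<bar>f (\<tau>(x := c)) - f \<tau>\<bar> \<le> W)"

lemma osc_leD: "osc_le f x W \<Longrightarrow> \<bar>f (\<tau>(x := c)) - f \<tau>\<bar> \<le> W"
  by (simp add: osc_le_def)

lemma osc_le_nonneg: "osc_le f x W \<Longrightarrow> 0 \<le> W"
  by (rule order_trans[OF abs_ge_zero osc_leD])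

locale coloring_graph =
  fixes E :: "nat \<Rightarrow> nat \<Rightarrow> bool" and k \<Delta> :: nat
  assumes symp_E: "symp E" and irrefl: "\<not> E v v"
    and finite_nbrs: "finite {u. E v u}" and degree_le: "card {u. E v u} \<le> \<Delta>"
    and colors: "2 * \<Delta> < k"
begin

text \<open>Colorings are functions on all of \<open>\<nat>\<close>, and only the edges meeting \<open>S\<close> are constrained. So
  block updates make sense from improper colorings as well, and any two colorings that agree outside
  a finite set are joined by single-vertex changes.\<close>

definition recolorings :: "nat set \<Rightarrow> (nat \<Rightarrow> nat) \<Rightarrow> (nat \<Rightarrow> nat) set" where
  "recolorings S \<sigma> = {\<tau>. (\<forall>x. x \<notin> S \<longrightarrow> \<tau> x = \<sigma> x) \<and> (\<forall>x\<in>S. \<tau> x < k \<and> (\<forall>y. E x y \<longrightarrow> \<tau> x \<noteq> \<tau> y))}"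

text \<open>The transition operator of resampling \<open>S\<close>: the expectation of
  \<open>f\<close> after a uniform recoloring of \<open>S\<close> with \<open>\<sigma>\<close> kept
  outside.\<close>

definition avg :: "nat set \<Rightarrow> ((nat \<Rightarrow> nat) \<Rightarrow> real) \<Rightarrow> (nat \<Rightarrow> nat) \<Rightarrow> real" where
  "avg S f \<sigma> = sum f (recolorings S \<sigma>) / real (card (recolorings S \<sigma>))"

section \<open>Counting recolorings\<close>

lemma E_sym: "E x y \<Longrightarrow> E y x"
  using symp_E by (rule sympD)

lemma finite_recolorings: "finite S \<Longrightarrow> finite (recolorings S \<sigma>)"
proof (rule finite_subset)
  show "recolorings S \<sigma> \<subseteq> (\<lambda>h x. if x \<in> S then h x else \<sigma> x) ` (S \<rightarrow>\<^sub>E {..<k})"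
  proof
    fix \<tau> assume \<tau>: "\<tau> \<in> recolorings S \<sigma>"
    then have "\<tau> = (\<lambda>x. if x \<in> S then restrict \<tau> S x else \<sigma> x)"
      by (auto simp: recolorings_def fun_eq_iff)
    moreover have "restrict \<tau> S \<in> S \<rightarrow>\<^sub>E {..<k}"
      using \<tau> by (auto simp: recolorings_def)
    ultimately show "\<tau> \<in> (\<lambda>h x. if x \<in> S then h x else \<sigma> x) ` (S \<rightarrow>\<^sub>E {..<k})"
      by blast
  qed
qed (auto intro: finite_PiE)

lemma card_available_colors: "k - \<Delta> \<le> card {b. b < k \<and> (\<forall>y. E u y \<longrightarrow> b \<noteq> \<tau> y)}"
proof -
  have eq: "{b. b < k \<and> (\<forall>y. E u y \<longrightarrow> b \<noteq> \<tau> y)} = {..<k} - \<tau> ` {y. E u y}" by auto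
  have "card (\<tau> ` {y. E u y}) \<le> \<Delta>"
    using card_image_le[OF finite_nbrs] degree_le order_trans by blast
  then show ?thesis
    unfolding eq using diff_card_le_card_Diff[of "\<tau> ` {y. E u y}" "{..<k}"] finite_nbrs by auto
qed

text \<open>The color \<open>c\<close> of \<open>u\<close> beforehand is arbitrary. So this serves
  both to extend a recoloring to the new vertex \<open>u\<close> and to change the color of
  \<open>u\<close> within a recoloring of \<open>S\<close>.\<close>

lemma recolor_vertex:
  assumes \<tau>: "\<tau> \<in> recolorings (S - {u}) (\<sigma>(u := c))"
    and b: "b < k" "\<And>y. E u y \<Longrightarrow> b \<noteq> \<tau> y" and "u \<in> S"
  shows "\<tau>(u := b) \<in> recolorings S \<sigma>"
proof -
  have "(\<tau>(u := b)) x \<noteq> (\<tau>(u := b)) y" if "x \<in> S" "E x y" for x y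
  proof -
    have "x \<noteq> y" using that irrefl by blast
    moreover have "\<tau> x \<noteq> b" if "y = u"
      using b(2)[OF E_sym] \<open>E x y\<close> that by metis
    moreover have "b \<noteq> \<tau> y" if "x = u" using b(2) \<open>E x y\<close> that by blast
    moreover have "\<tau> x \<noteq> \<tau> y" if "x \<noteq> u"
      using \<tau> \<open>x \<in> S\<close> \<open>E x y\<close> that by (simp add: recolorings_def)
    ultimately show ?thesis by auto
  qed
  then show ?thesis using \<tau> b(1) \<open>u \<in> S\<close> by (auto simp: recolorings_def)
qed

lemma recolorings_nonempty: "finite S \<Longrightarrow> recolorings S \<sigma> \<noteq> {}"
proof (induction S rule: finite_induct)
  case empty
  then show ?case by (auto simp: recolorings_def)
next
  case (insert u S)
  then obtain \<tau> where "\<tau> \<in> recolorings S \<sigma>" by blast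
  moreover have "card {b. b < k \<and> (\<forall>y. E u y \<longrightarrow> b \<noteq> \<tau> y)} > 0"
    using card_available_colors[of u \<tau>] colors by linarith
  then obtain b where "b < k" "\<forall>y. E u y \<longrightarrow> b \<noteq> \<tau> y"
    by (auto simp: card_gt_0_iff)
  ultimately have "\<tau>(u := b) \<in> recolorings (insert u S) \<sigma>"
    using insert.hyps by (intro recolor_vertex[where c = "\<sigma> u"]) auto
  then show ?case by blast
qed

lemma card_recolorings_pos: "finite S \<Longrightarrow> card (recolorings S \<sigma>) > 0"
  using finite_recolorings recolorings_nonempty by (simp add: card_gt_0_iff)

text \<open>A uniform recoloring gives \<open>u\<close> the color \<open>c\<close> with probability
  at most \<open>1 / (k - \<Delta>)\<close>. Each recoloring with color \<open>c\<close> at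
  \<open>u\<close> yields at least \<open>k - \<Delta>\<close> recolorings by changing
  \<open>u\<close> alone, and putting \<open>c\<close> back recovers the original, so none is
  counted twice.\<close>

lemma recolorings_fixed_color_card_le:
  assumes "finite S" "u \<in> S"
  shows "(k - \<Delta>) * card {\<tau> \<in> recolorings S \<sigma>. \<tau> u = c} \<le> card (recolorings S \<sigma>)"
proof -
  let ?T = "{\<tau> \<in> recolorings S \<sigma>. \<tau> u = c}"
  let ?A = "\<lambda>\<tau>. {b. b < k \<and> (\<forall>y. E u y \<longrightarrow> b \<noteq> \<tau> y)}"
  have fin: "finite ?T" using finite_recolorings[OF assms(1)] by simp
  have "(k - \<Delta>) * card ?T = (\<Sum>\<tau>\<in>?T. k - \<Delta>)" by simp
  also have "\<dots> \<le> (\<Sum>\<tau>\<in>?T. card (?A \<tau>))"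
    by (intro sum_mono card_available_colors)
  also have "\<dots> = card (Sigma ?T ?A)"
    using fin by (subst card_SigmaI) auto
  also have "\<dots> \<le> card (recolorings S \<sigma>)"
  proof (rule card_inj_on_le)
    show "inj_on (\<lambda>(\<tau>, b). \<tau>(u := b)) (Sigma ?T ?A)"
    proof (rule inj_onI, clarsimp)
      fix \<tau> b \<tau>' b' assume c: "c = \<tau> u" "\<tau>' u = \<tau> u" and eq: "\<tau>(u := b) = \<tau>'(u := b')"
      have "b = b'" using fun_cong[OF eq, of u] by simp
      moreover have "\<tau> x = \<tau>' x" for x
        using fun_cong[OF eq, of x] c by (cases "x = u") auto
      ultimately show "\<tau> = \<tau>' \<and> b = b'" by auto
    qed
    show "(\<lambda>(\<tau>, b). \<tau>(u := b)) ` Sigma ?T ?A \<subseteq> recolorings S \<sigma>"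
    proof clarsimp
      fix \<tau> b assume "\<tau> \<in> recolorings S \<sigma>" "b < k" "\<forall>y. E u y \<longrightarrow> b \<noteq> \<tau> y"
      then show "\<tau>(u := b) \<in> recolorings S \<sigma>"
        using assms(2) by (intro recolor_vertex[where c = "\<tau> u"]) (auto simp: recolorings_def)
    qed
  qed (rule finite_recolorings[OF assms(1)])
  finally show ?thesis .
qed

lemma recolorings_change_boundary:
  assumes "\<And>x y. x \<in> S \<Longrightarrow> E x y \<Longrightarrow> y \<notin> S \<Longrightarrow> \<sigma> y = \<sigma>' y"
  shows "bij_betw (\<lambda>\<tau> x. if x \<in> S then \<tau> x else \<sigma>' x) (recolorings S \<sigma>) (recolorings S \<sigma>')"
proof -
  have maps: "(\<lambda>x. if x \<in> S then \<tau> x else \<rho>' x) \<in> recolorings S \<rho>'"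
    if \<tau>: "\<tau> \<in> recolorings S \<rho>" and \<rho>: "\<And>x y. x \<in> S \<Longrightarrow> E x y \<Longrightarrow> y \<notin> S \<Longrightarrow> \<rho> y = \<rho>' y" for \<tau> \<rho> \<rho>'
  proof -
    have "\<tau> x \<noteq> \<rho>' y" if "x \<in> S" "E x y" "y \<notin> S" for x y
      using \<rho>[OF that] \<tau> that by (auto simp: recolorings_def) metis
    then show ?thesis using \<tau> by (auto simp: recolorings_def)
  qed
  show ?thesis
  proof (rule bij_betw_byWitness[where f' = "\<lambda>\<tau> x. if x \<in> S then \<tau> x else \<sigma> x"])
    show "(\<lambda>\<tau> x. if x \<in> S then \<tau> x else \<sigma>' x) ` recolorings S \<sigma> \<subseteq> recolorings S \<sigma>'"
      "(\<lambda>\<tau> x. if x \<in> S then \<tau> x else \<sigma> x) ` recolorings S \<sigma>' \<subseteq> recolorings S \<sigma>"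
      using assms by (auto intro!: maps)
  qed (auto simp: recolorings_def)
qed

section \<open>Averages when the color of one vertex changes\<close>

lemma recolorings_upd_inside: "v \<in> S \<Longrightarrow> recolorings S (\<sigma>(v := c)) = recolorings S \<sigma>"
  by (auto simp: recolorings_def)

lemma bij_betw_recolorings_upd:
  assumes "v \<notin> S" "\<And>x. x \<in> S \<Longrightarrow> \<not> E v x"
  shows "bij_betw (\<lambda>\<tau>. \<tau>(v := c)) (recolorings S \<sigma>) (recolorings S (\<sigma>(v := c)))"
proof -
  have "bij_betw (\<lambda>\<tau> x. if x \<in> S then \<tau> x else (\<sigma>(v := c)) x)
          (recolorings S \<sigma>) (recolorings S (\<sigma>(v := c)))"
    using assms E_sym by (intro recolorings_change_boundary) auto
  moreover have "(\<lambda>x. if x \<in> S then \<tau> x else (\<sigma>(v := c)) x) = \<tau>(v := c)"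
    if "\<tau> \<in> recolorings S \<sigma>" for \<tau>
    using that assms(1) by (auto simp: recolorings_def fun_eq_iff)
  ultimately show ?thesis by (simp cong: bij_betw_cong)
qed

text \<open>If \<open>v\<close> lies in \<open>S\<close>, its old color is overwritten. Otherwise
  the recolorings for the two colors of \<open>v\<close> are matched so that they differ at
  \<open>v\<close> only.\<close>

lemma avg_upd_isolated:
  assumes "finite S" "\<And>x. x \<in> S \<Longrightarrow> \<not> E v x" "osc_le f v W"
  shows "osc_le (avg S f) v W"
  unfolding osc_le_def
proof (intro allI, cases "v \<in> S")
  fix \<sigma> c
  assume "v \<in> S"
  then show "\<bar>avg S f (\<sigma>(v := c)) - avg S f \<sigma>\<bar> \<le> W"
    using osc_le_nonneg[OF assms(3)] by (simp add: avg_def recolorings_upd_inside)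
next
  fix \<sigma> c assume "v \<notin> S"
  note bij = bij_betw_recolorings_upd[OF this assms(2), where \<sigma> = \<sigma> and c = c]
  define n where "n = real (card (recolorings S \<sigma>))"
  have "n > 0" using card_recolorings_pos[OF assms(1)] by (simp add: n_def)
  have "avg S f (\<sigma>(v := c)) - avg S f \<sigma> = (\<Sum>\<tau>\<in>recolorings S \<sigma>. f (\<tau>(v := c)) - f \<tau>) / n"
    using bij_betw_same_card[OF bij] sum.reindex_bij_betw[OF bij, of f]
    by (simp add: avg_def n_def sum_subtractf diff_divide_distrib)
  moreover have "\<bar>\<Sum>\<tau>\<in>recolorings S \<sigma>. f (\<tau>(v := c)) - f \<tau>\<bar> \<le> (\<Sum>\<tau>\<in>recolorings S \<sigma>. W)"
    using osc_leD[OF assms(3)] by (intro order_trans[OF sum_abs] sum_mono)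
  then have "\<bar>\<Sum>\<tau>\<in>recolorings S \<sigma>. f (\<tau>(v := c)) - f \<tau>\<bar> \<le> n * W" by (simp add: n_def)
  ultimately show "\<bar>avg S f (\<sigma>(v := c)) - avg S f \<sigma>\<bar> \<le> W"
    using \<open>n > 0\<close> by (simp add: abs_divide pos_divide_le_eq mult.commute)
qed

text \<open>Without edges between \<open>C\<close> and \<open>D\<close>, the number of recolorings
  of \<open>D\<close> is the same after every recoloring of \<open>C\<close>. Hence choosing
  uniformly in two stages is uniform on the union.\<close>

lemma avg_union:
  assumes "finite C" "finite D" "C \<inter> D = {}" "\<And>x y. x \<in> C \<Longrightarrow> y \<in> D \<Longrightarrow> \<not> E x y"
  shows "avg (C \<union> D) f \<sigma> = avg C (avg D f) \<sigma>"
proof -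
  have eq: "recolorings (C \<union> D) \<sigma> = (\<Union>\<tau>\<in>recolorings C \<sigma>. recolorings D \<tau>)"
  proof (intro equalityI subsetI)
    fix \<rho> assume \<rho>: "\<rho> \<in> recolorings (C \<union> D) \<sigma>"
    \<comment> \<open>The intermediate coloring has the final colors on \<open>C\<close> and still
      the old ones on \<open>D\<close>.\<close>
    let ?\<tau> = "\<lambda>x. if x \<in> D then \<sigma> x else \<rho> x"
    have "?\<tau> \<in> recolorings C \<sigma>" "\<rho> \<in> recolorings D ?\<tau>"
      using \<rho> assms(3,4) by (auto simp: recolorings_def)
    then show "\<rho> \<in> (\<Union>\<tau>\<in>recolorings C \<sigma>. recolorings D \<tau>)" by blast
  next
    fix \<rho> assume "\<rho> \<in> (\<Union>\<tau>\<in>recolorings C \<sigma>. recolorings D \<tau>)"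
    then obtain \<tau> where \<tau>: "\<tau> \<in> recolorings C \<sigma>" "\<rho> \<in> recolorings D \<tau>" by blast
    have off: "\<rho> x = \<tau> x" if "x \<notin> D" for x using \<tau>(2) that by (auto simp: recolorings_def)
    have "\<rho> x \<noteq> \<rho> y" if "x \<in> C" "E x y" for x y
    proof -
      have "x \<notin> D" "y \<notin> D" using that assms(3,4) by auto
      then show ?thesis using that off \<tau>(1) by (auto simp: recolorings_def)
    qed
    then show "\<rho> \<in> recolorings (C \<union> D) \<sigma>"
      using \<tau> off assms(3) by (auto simp: recolorings_def)
  qed
  have disj: "recolorings D \<tau> \<inter> recolorings D \<tau>' = {}"
    if "\<tau> \<in> recolorings C \<sigma>" "\<tau>' \<in> recolorings C \<sigma>" "\<tau> \<noteq> \<tau>'" for \<tau> \<tau>'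
  proof (rule ccontr)
    assume "recolorings D \<tau> \<inter> recolorings D \<tau>' \<noteq> {}"
    then obtain \<rho> where "\<rho> \<in> recolorings D \<tau>" "\<rho> \<in> recolorings D \<tau>'" by blast
    then have "\<tau> x = \<tau>' x" if "x \<notin> D" for x
      using that by (simp add: recolorings_def)
    moreover have "\<tau> x = \<tau>' x" if "x \<notin> C" for x
      using that \<open>\<tau> \<in> _\<close> \<open>\<tau>' \<in> _\<close> by (simp add: recolorings_def)
    ultimately have "\<tau> = \<tau>'" using assms(3) by blast
    then show False using that(3) by contradiction
  qed
  have card: "card (recolorings D \<tau>) = card (recolorings D \<sigma>)" if "\<tau> \<in> recolorings C \<sigma>" for \<tau>
  proof (intro bij_betw_same_card[OF recolorings_change_boundary])
    fix x y assume "x \<in> D" "E x y"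
    then have "y \<notin> C" using assms(4) E_sym by blast
    then show "\<tau> y = \<sigma> y" using that by (simp add: recolorings_def)
  qed
  have sums: "sum h (recolorings (C \<union> D) \<sigma>) = (\<Sum>\<tau>\<in>recolorings C \<sigma>. sum h (recolorings D \<tau>))"
    for h :: "_ \<Rightarrow> real"
    unfolding eq using disj assms(1,2) finite_recolorings by (intro sum.UNION_disjoint) auto
  have "real (card (recolorings (C \<union> D) \<sigma>)) = card (recolorings C \<sigma>) * card (recolorings D \<sigma>)"
    using sums[of "\<lambda>_. 1"] card by simp
  then show ?thesis
    unfolding avg_def sums using card by (simp add: sum_divide_distrib mult.commute)
qed

text \<open>Only neighbors outside \<open>S\<close> restrict the color of \<open>u\<close>; the
  vertices of \<open>S\<close> are recolored after \<open>u\<close> has been given its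
  color.\<close>

definition allowed :: "nat set \<Rightarrow> nat \<Rightarrow> (nat \<Rightarrow> nat) \<Rightarrow> nat set" where
  "allowed S u \<sigma> = {a. a < k \<and> (\<forall>y. y \<notin> S \<longrightarrow> E u y \<longrightarrow> a \<noteq> \<sigma> y)}"

lemma recolorings_insert_fixed_color:
  assumes "u \<notin> S" "b \<in> allowed S u \<rho>"
  shows "{\<tau> \<in> recolorings (insert u S) \<rho>. \<tau> u = b} = recolorings S (\<rho>(u := b))"
proof (intro equalityI subsetI)
  fix \<tau> assume \<tau>: "\<tau> \<in> recolorings S (\<rho>(u := b))"
  have "\<tau> u = b" using \<tau> assms(1) by (simp add: recolorings_def)
  moreover have "\<tau> y \<noteq> b" if "E u y" for y
  proof (cases "y \<in> S")
    case True
    then have "\<tau> y \<noteq> \<tau> u" using \<tau> E_sym[OF that] by (simp add: recolorings_def)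
    then show ?thesis using \<open>\<tau> u = b\<close> by simp
  next
    case False
    moreover have "y \<noteq> u" using that irrefl by blast
    ultimately have "\<tau> y = \<rho> y" using \<tau> by (simp add: recolorings_def)
    then show ?thesis using assms(2) that False by (simp add: allowed_def) metis
  qed
  ultimately have "\<tau> u < k \<and> (\<forall>y. E u y \<longrightarrow> \<tau> u \<noteq> \<tau> y)"
    using assms(2) unfolding allowed_def by force
  moreover have "\<forall>x. x \<notin> insert u S \<longrightarrow> \<tau> x = \<rho> x"
    using \<tau> by (simp add: recolorings_def)
  moreover have "\<forall>x\<in>S. \<tau> x < k \<and> (\<forall>y. E x y \<longrightarrow> \<tau> x \<noteq> \<tau> y)"
    using \<tau> unfolding recolorings_def by blast
  ultimately show "\<tau> \<in> {\<tau> \<in> recolorings (insert u S) \<rho>. \<tau> u = b}"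
    unfolding recolorings_def using \<open>\<tau> u = b\<close> by blast
qed (auto simp: recolorings_def)

lemma sum_recolorings_insert:
  fixes f :: "_ \<Rightarrow> real"
  assumes "finite S" "u \<notin> S"
  shows "sum f (recolorings (insert u S) \<sigma>) = (\<Sum>a\<in>allowed S u \<sigma>. sum f (recolorings S (\<sigma>(u := a))))"
proof -
  have "\<rho> u \<in> allowed S u \<sigma>" if \<rho>: "\<rho> \<in> recolorings (insert u S) \<sigma>" for \<rho>
  proof -
    have "\<rho> u \<noteq> \<sigma> y" if "y \<notin> S" "E u y" for y
    proof -
      have "y \<noteq> u" using that irrefl by blast
      then have "\<rho> y = \<sigma> y" "\<rho> u \<noteq> \<rho> y" using \<rho> that by (auto simp: recolorings_def)
      then show ?thesis by simp
    qed
    then show ?thesis using \<rho> by (simp add: recolorings_def allowed_def)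
  qed
  then have "recolorings (insert u S) \<sigma> =
      (\<Union>a\<in>allowed S u \<sigma>. {\<tau> \<in> recolorings (insert u S) \<sigma>. \<tau> u = a})"
    by auto
  also have "\<dots> = (\<Union>a\<in>allowed S u \<sigma>. recolorings S (\<sigma>(u := a)))"
    by (intro SUP_cong recolorings_insert_fixed_color[OF assms(2)]) auto
  finally have eq: "recolorings (insert u S) \<sigma> = (\<Union>a\<in>allowed S u \<sigma>. recolorings S (\<sigma>(u := a)))" .
  have "recolorings S (\<sigma>(u := a)) \<inter> recolorings S (\<sigma>(u := b)) = {}" if "a \<noteq> b" for a b
    using that assms(2) by (auto simp: recolorings_def)
  then show ?thesis
    unfolding eq using finite_recolorings[OF assms(1)] by (intro sum.UNION_disjoint) (auto simp: allowed_def)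
qed

text \<open>Total expectation, conditioning on the color of \<open>u\<close>: a color is weighted by
  the number of its extensions to \<open>S\<close>.\<close>

lemma avg_insert:
  assumes "finite S" "u \<notin> S"
  shows "avg (insert u S) f \<sigma> =
    (\<Sum>a\<in>allowed S u \<sigma>. real (card (recolorings S (\<sigma>(u := a)))) * avg S f (\<sigma>(u := a))) /
    (\<Sum>a\<in>allowed S u \<sigma>. real (card (recolorings S (\<sigma>(u := a)))))"
proof -
  have "real (card (recolorings S \<tau>)) * avg S f \<tau> = sum f (recolorings S \<tau>)" for \<tau>
    using card_recolorings_pos[OF assms(1), of \<tau>] by (simp add: avg_def)
  then show ?thesis
    using sum_recolorings_insert[OF assms, of f] sum_recolorings_insert[OF assms, of "\<lambda>_. 1"]
    by (simp add: avg_def[of "insert u S"])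
qed

text \<open>The term \<open>W\<close> is the direct dependence of \<open>f\<close> on
  \<open>v\<close>. Inside the tree the change is felt only through \<open>u\<close>, whose
  forbidden color switches from \<open>\<sigma> v\<close> to \<open>c\<close>; the two distributions
  of the color of \<open>u\<close> differ little because no color has probability above
  \<open>1 / (k - \<Delta>)\<close>.\<close>

lemma avg_upd_root:
  assumes "finite S" "u \<notin> S" "v \<notin> insert u S" "E v u" "\<And>x. x \<in> S \<Longrightarrow> \<not> E v x"
    and v: "osc_le f v W" and u: "osc_le (avg S f) u M"
  shows "osc_le (avg (insert u S) f) v (W + M / real (k - \<Delta>))"
  unfolding osc_le_def
proof (intro allI, goal_cases)
  case (1 \<sigma> c)
  show ?case
  proof (cases "c = \<sigma> v")
    case True
    then show ?thesis using osc_le_nonneg[OF u] osc_le_nonneg[OF v] by simp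
  next
    case False
    \<comment> \<open>The colors of \<open>u\<close> permitted by all outside neighbors except
      \<open>v\<close>; the color of \<open>v\<close> then removes one more.\<close>
    define A where "A = {a. a < k \<and> (\<forall>y. y \<notin> insert v S \<longrightarrow> E u y \<longrightarrow> a \<noteq> \<sigma> y)}"
    define z where "z a = real (card (recolorings S (\<sigma>(u := a))))" for a
    define h where "h a = avg S f (\<sigma>(u := a))" for a
    define h' where "h' a = avg S f (\<sigma>(v := c, u := a))" for a
    have uv: "u \<noteq> v" "E u v" using assms(3) E_sym[OF assms(4)] by auto
    have allowed: "allowed S u \<sigma> = A - {\<sigma> v}" "allowed S u (\<sigma>(v := c)) = A - {c}"
      using uv assms(3) by (auto simp: allowed_def A_def)
    \<comment> \<open>As \<open>v\<close> has no neighbor in \<open>S\<close>, its color does not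
      affect the number of extensions.\<close>
    have z': "real (card (recolorings S (\<sigma>(v := c, u := a)))) = z a" for a
      using bij_betw_same_card[OF bij_betw_recolorings_upd[of v S, where \<sigma> = "\<sigma>(u := a)" and c = c]] assms(3,5) uv(1)
      by (simp add: z_def fun_upd_twist)
    have h': "\<bar>h' a - h a\<bar> \<le> W" for a
      using osc_leD[OF avg_upd_isolated[OF assms(1,5) v], of "\<sigma>(u := a)" c] uv(1)
      by (simp add: h_def h'_def fun_upd_twist)
    have avg1: "avg (insert u S) f \<sigma> = (\<Sum>a\<in>A - {\<sigma> v}. z a * h a) / sum z (A - {\<sigma> v})"
      unfolding avg_insert[OF assms(1,2)] allowed by (simp add: z_def h_def)
    have avg2: "avg (insert u S) f (\<sigma>(v := c)) = (\<Sum>a\<in>A - {c}. z a * h' a) / sum z (A - {c})"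
      unfolding avg_insert[OF assms(1,2)] allowed by (simp add: z' h'_def)
    have cards: "real (card (recolorings (insert u S) \<sigma>)) = sum z (A - {\<sigma> v})"
      "real (card (recolorings (insert u S) (\<sigma>(v := c)))) = sum z (A - {c})"
      using sum_recolorings_insert[OF assms(1,2), of "\<lambda>_. 1"] allowed by (simp_all add: z_def z')
    have pos: "sum z (A - {\<sigma> v}) > 0" "sum z (A - {c}) > 0"
      unfolding cards[symmetric] using card_recolorings_pos assms(1) by auto
    have fixed: "real (k - \<Delta>) * card (recolorings S (\<rho>(u := b))) \<le> card (recolorings (insert u S) \<rho>)"
      if "b \<in> allowed S u \<rho>" for b \<rho>
      using recolorings_fixed_color_card_le[of "insert u S" u \<rho> b] assms(1)
        recolorings_insert_fixed_color[OF assms(2) that]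
      by (metis finite.insertI insertI1 of_nat_le_iff of_nat_mult)
    have small: "real (k - \<Delta>) * z b \<le> sum z (A - {\<sigma> v})" if "b \<in> A - {\<sigma> v}" for b
      using fixed[of b \<sigma>] that unfolding cards[symmetric] allowed z_def by simp
    have small': "real (k - \<Delta>) * z b \<le> sum z (A - {c})" if "b \<in> A - {c}" for b
      using fixed[of b "\<sigma>(v := c)"] that unfolding cards[symmetric] allowed z'[symmetric] by simp
    \<comment> \<open>The edge between \<open>u\<close> and \<open>v\<close> excludes
      \<open>\<Delta> = 0\<close>, so \<open>k - \<Delta> > \<Delta>\<close> gives the strict bound
      that the comparison of means requires.\<close>
    have "\<Delta> > 0"
      using degree_le[of u] uv(2) finite_nbrs[of u] by (cases "\<Delta> = 0") auto
    then have k: "real (k - \<Delta>) > 1" using colors by linarith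
    have hd: "\<bar>h a - h b\<bar> \<le> M" for a b
      using osc_leD[OF u, of "\<sigma>(u := b)" a] by (simp add: h_def)
    have "\<bar>(\<Sum>a\<in>A - {c}. z a * h a) / sum z (A - {c}) -
            (\<Sum>a\<in>A - {\<sigma> v}. z a * h a) / sum z (A - {\<sigma> v})\<bar> \<le> M / real (k - \<Delta>)"
      using pos small small' False k hd
      by (intro weighted_mean_remove_point_diff) (auto simp: A_def z_def)
    moreover have "\<bar>(\<Sum>a\<in>A - {c}. z a * h' a) / sum z (A - {c}) -
       (\<Sum>a\<in>A - {c}. z a * h a) / sum z (A - {c})\<bar> \<le> W"
    proof -
      have "\<bar>\<Sum>a\<in>A - {c}. z a * (h' a - h a)\<bar> \<le> (\<Sum>a\<in>A - {c}. z a * W)"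
        using h' by (intro order_trans[OF sum_abs] sum_mono) (auto simp: abs_mult z_def intro!: mult_left_mono)
      then have "\<bar>\<Sum>a\<in>A - {c}. z a * (h' a - h a)\<bar> \<le> sum z (A - {c}) * W"
        by (simp add: sum_distrib_right)
      moreover have "(\<Sum>a\<in>A - {c}. z a * h' a) / sum z (A - {c}) -
        (\<Sum>a\<in>A - {c}. z a * h a) / sum z (A - {c}) = (\<Sum>a\<in>A - {c}. z a * (h' a - h a)) / sum z (A - {c})"
        by (simp add: right_diff_distrib sum_subtractf diff_divide_distrib)
      ultimately show ?thesis using pos by (simp add: abs_divide field_simps)
    qed
    moreover have "\<bar>x - y\<bar> \<le> r + t" if "\<bar>s - y\<bar> \<le> t" "\<bar>x - s\<bar> \<le> r" for x y s r t :: real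
      using that by linarith
    ultimately show ?thesis unfolding avg1 avg2 by blast
  qed
qed

text \<open>Both \<open>f\<close> and \<open>w\<close> are general in the induction: averaging over
  one part of the forest replaces \<open>f\<close> by another function, whose dependence on
  \<open>v\<close> is larger.\<close>

lemma tree_attached_influence:
  fixes w :: "nat \<Rightarrow> real"
  assumes "tree_attached E v S" "finite S" "v \<notin> S" "L \<ge> 0"
    and "\<And>x. x \<in> insert v S \<Longrightarrow> osc_le f x (L * w x)"
    and "\<And>x. x \<in> S \<Longrightarrow> w x + real (card {y \<in> S. E x y}) \<le> real (k - \<Delta>)"
  shows "osc_le (avg S f) v (L * (w v + real (card {y \<in> S. E v y})))"
  using assms
proof (induction arbitrary: f w rule: tree_attached.induct)
  case (isolated S v)
  then have "{y \<in> S. E v y} = {}" by auto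
  then have "card {y \<in> S. E v y} = 0" by (simp only: card.empty)
  moreover have "osc_le (avg S f) v (L * w v)"
    using isolated by (intro avg_upd_isolated) auto
  ultimately show ?case by simp
next
  case (union v C D)
  have fin: "finite C" "finite D" using union.prems(1) by auto
  have mono: "w x + real (card {y \<in> S. E x y}) \<le> real (k - \<Delta>)" if "x \<in> S" "S \<subseteq> C \<union> D" for x S
  proof -
    have "card {y \<in> S. E x y} \<le> card {y \<in> C \<union> D. E x y}"
      using that union.prems(1) by (intro card_mono) auto
    then show ?thesis using union.prems(5)[of x] that by fastforce
  qed
  \<comment> \<open>Resampling \<open>D\<close> first adds its influence to the dependence on
    \<open>v\<close>. Charging this to the weight of \<open>v\<close> lets the induction hypothesis
    for \<open>C\<close> be applied to \<open>avg D f\<close>.\<close>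
  define w' where "w' = w(v := w v + real (card {y \<in> D. E v y}))"
  have D: "osc_le (avg D f) v (L * (w v + real (card {y \<in> D. E v y})))"
    using union.prems mono fin by (intro union.IH(2)) auto
  have C: "osc_le (avg D f) x (L * w x)" if "x \<in> C" for x
    using that union fin by (intro avg_upd_isolated) auto
  have "osc_le (avg C (avg D f)) v (L * (w' v + real (card {y \<in> C. E v y})))"
  proof (rule union.IH(1))
    show "osc_le (avg D f) x (L * w' x)" if "x \<in> insert v C" for x
      using that C D union.prems(2) by (auto simp: w'_def)
    show "w' x + real (card {y \<in> C. E x y}) \<le> real (k - \<Delta>)" if "x \<in> C" for x
      using that mono[of x C] union.prems(2) by (auto simp: w'_def)
  qed (use union.prems fin in auto)
  moreover have "{y \<in> C \<union> D. E v y} = {y \<in> C. E v y} \<union> {y \<in> D. E v y}" by auto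
  then have "card {y \<in> C \<union> D. E v y} = card {y \<in> C. E v y} + card {y \<in> D. E v y}"
    using union.hyps(3) fin by (simp only:) (rule card_Un_disjoint, auto)
  moreover have "avg (C \<union> D) f = avg C (avg D f)"
    using avg_union[OF fin union.hyps(3,4)] by blast
  ultimately show ?case by (simp add: w'_def algebra_simps)
next
  case (root u S v)
  have fin: "finite S" using root.prems(1) by auto
  have le: "w x + real (card {y \<in> S. E x y}) \<le> real (k - \<Delta>)" if "x \<in> insert u S" for x
  proof -
    have "card {y \<in> S. E x y} \<le> card {y \<in> insert u S. E x y}"
      using fin by (intro card_mono) auto
    then show ?thesis using root.prems(5)[OF that] by linarith
  qed
  have "osc_le (avg S f) u (L * (w u + real (card {y \<in> S. E u y})))"
    using root.prems root.hyps le fin by (intro root.IH) auto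
  \<comment> \<open>The factor \<open>k - \<Delta>\<close> cancels the probability that the
    disagreement reaches \<open>u\<close>, so the whole subtree below \<open>u\<close> costs at most
    \<open>L\<close>.\<close>
  moreover have "L * (w u + real (card {y \<in> S. E u y})) \<le> L * real (k - \<Delta>)"
    using le[of u] root.prems(3) by (intro mult_left_mono) auto
  ultimately have "osc_le (avg S f) u (L * real (k - \<Delta>))"
    unfolding osc_le_def using order_trans by blast
  then have "osc_le (avg (insert u S) f) v (L * w v + L * real (k - \<Delta>) / real (k - \<Delta>))"
    using root.prems root.hyps fin by (intro avg_upd_root) auto
  moreover have "{y \<in> insert u S. E v y} = {u}" using root.hyps by auto
  then have "card {y \<in> insert u S. E v y} = 1" by simp
  moreover have "real (k - \<Delta>) \<noteq> 0" using colors by simp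
  ultimately show ?case by (simp add: distrib_left del: of_nat_diff)
qed

end

section \<open>Contraction of the block dynamics\<close>

text \<open>Vertices of \<open>F\<close> are switched from \<open>\<sigma>\<close> to
  \<open>\<tau>\<close> one at a time; the intermediate colorings may be improper.\<close>

lemma osc_le_telescope:
  assumes "finite F" "\<And>x. x \<in> F \<Longrightarrow> osc_le h x (W x)" "\<And>x. x \<notin> F \<Longrightarrow> \<sigma> x = \<tau> x"
  shows "\<bar>h \<sigma> - h \<tau>\<bar> \<le> sum W F"
  using assms
proof (induction F arbitrary: \<sigma> rule: finite_induct)
  case empty
  then have "\<sigma> = \<tau>" by blast
  then show ?case by simp
next
  case (insert u F)
  have "\<bar>h (\<sigma>(u := \<tau> u)) - h \<tau>\<bar> \<le> sum W F"
    using insert.prems by (intro insert.IH) auto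
  moreover have "\<bar>h (\<sigma>(u := \<tau> u)) - h \<sigma>\<bar> \<le> W u"
    using insert.prems(1)[of u] by (intro osc_leD) simp
  ultimately show ?case using insert.hyps by simp
qed

lemma osc_le_mean:
  assumes "\<And>i. i < N \<Longrightarrow> osc_le (g i) v (b i)"
  shows "osc_le (\<lambda>\<sigma>. (\<Sum>i<N. g i \<sigma>) / real N) v ((\<Sum>i<N. b i) / real N)"
  unfolding osc_le_def
proof (intro allI)
  fix \<tau> c
  have "\<bar>\<Sum>i<N. g i (\<tau>(v := c)) - g i \<tau>\<bar> \<le> (\<Sum>i<N. b i)"
    using assms by (intro order_trans[OF sum_abs] sum_mono) (auto intro: osc_leD)
  then have "\<bar>\<Sum>i<N. g i (\<tau>(v := c)) - g i \<tau>\<bar> / real N \<le> (\<Sum>i<N. b i) / real N"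
    by (rule divide_right_mono) simp
  then show "\<bar>(\<Sum>i<N. g i (\<tau>(v := c))) / real N - (\<Sum>i<N. g i \<tau>) / real N\<bar> \<le> (\<Sum>i<N. b i) / real N"
    by (simp add: sum_subtractf diff_divide_distrib[symmetric] abs_divide)
qed

locale block_coloring = coloring_graph +
  fixes V :: "nat set" and N :: nat and B :: "nat \<Rightarrow> nat set"
  assumes finite_V: "finite V" and V_nonempty: "V \<noteq> {}"
    and edge_in_V: "E u v \<Longrightarrow> u \<in> V \<and> v \<in> V"
    and partition: "block_partition V N B"
    and tree: "i < N \<Longrightarrow> v \<notin> B i \<Longrightarrow> tree_attached E v (B i)"
begin

abbreviation "\<Omega> \<equiv> proper_colorings V E k"

text \<open>One plus the number of neighbors outside the own block: the sum over all other blocks of the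
  influence bounds then falls short of \<open>N * weight v\<close> by exactly one.\<close>

definition weight :: "nat \<Rightarrow> real" where
  "weight v = 1 + (\<Sum>i | i < N \<and> v \<notin> B i. real (card {y \<in> B i. E v y}))"

text \<open>The transition operator of the block dynamics acting on functions, extended to improper
  colorings.\<close>

definition update :: "((nat \<Rightarrow> nat) \<Rightarrow> real) \<Rightarrow> (nat \<Rightarrow> nat) \<Rightarrow> real" where
  "update f \<sigma> = (\<Sum>i<N. avg (B i) f \<sigma>) / real N"

section \<open>Weights and one step of the dynamics\<close>

lemma block_subset: "i < N \<Longrightarrow> B i \<subseteq> V"
  using partition by (auto simp: block_partition_def)

lemma finite_block: "i < N \<Longrightarrow> finite (B i)"
  by (rule finite_subset[OF block_subset finite_V])

lemma block_unique: "i < N \<Longrightarrow> j < N \<Longrightarrow> v \<in> B i \<Longrightarrow> v \<in> B j \<Longrightarrow> i = j"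
  using partition by (auto simp: block_partition_def)

lemma block_exists: "v \<in> V \<Longrightarrow> \<exists>i<N. v \<in> B i"
  using partition by (auto simp: block_partition_def)

lemma N_pos: "N > 0"
proof -
  obtain v where "v \<in> V" using V_nonempty by blast
  then obtain i where "i < N" using block_exists by blast
  then show ?thesis by simp
qed

lemma N_le_card: "N \<le> card V"
proof -
  have "N = (\<Sum>i<N. 1)" by simp
  also have "\<dots> \<le> (\<Sum>i<N. card (B i))"
    using partition finite_block
    by (intro sum_mono) (auto simp: block_partition_def Suc_le_eq card_gt_0_iff)
  also have "\<dots> = card (\<Union>i<N. B i)"
    using partition finite_block by (subst card_UN_disjoint) (auto simp: block_partition_def)
  finally show ?thesis using partition by (simp add: block_partition_def)
qed

lemma weight_ge_1: "weight v \<ge> 1"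
  by (simp add: weight_def sum_nonneg)

text \<open>The inner degree is exactly the block that \<open>weight\<close> omits, so the sum is
  one plus the number of all neighbors. Together with \<open>\<Delta> + 1 \<le> k - \<Delta>\<close>
  this is the hypothesis of the influence bound.\<close>

lemma weight_plus_inner_degree:
  assumes "j < N" "v \<in> B j"
  shows "weight v + real (card {y \<in> B j. E v y}) \<le> real \<Delta> + 1"
proof -
  have "{i. i < N \<and> v \<notin> B i} = {..<N} - {j}"
    using assms block_unique by auto
  then have "weight v + real (card {y \<in> B j. E v y}) = 1 + real (\<Sum>i<N. card {y \<in> B i. E v y})"
    using assms(1) by (simp add: weight_def sum.remove[of "{..<N}" j])
  also have "(\<Sum>i<N. card {y \<in> B i. E v y}) = card (\<Union>i<N. {y \<in> B i. E v y})"
    using finite_block block_unique by (subst card_UN_disjoint) auto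
  also have "\<dots> \<le> card {y. E v y}"
    using finite_nbrs by (intro card_mono) auto
  finally show ?thesis using degree_le[of v] by linarith
qed

lemma weight_le:
  assumes "v \<in> V"
  shows "weight v \<le> real \<Delta> + 1"
proof -
  obtain j where "j < N" "v \<in> B j" using block_exists[OF assms] by blast
  from weight_plus_inner_degree[OF this] show ?thesis by linarith
qed

lemma update_contracts:
  assumes "L \<ge> 0" "\<And>x. x \<in> V \<Longrightarrow> osc_le f x (L * weight x)" "v \<in> V"
  shows "osc_le (update f) v (L * (1 - 1 / (real N * (real \<Delta> + 1))) * weight v)"
proof -
  obtain j where j: "j < N" "v \<in> B j" using block_exists[OF assms(3)] by blast
  \<comment> \<open>Resampling the block of \<open>v\<close> erases the disagreement; every other
    block keeps it and may spread it.\<close>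
  define b where "b i = (if v \<in> B i then 0 else L * (weight v + real (card {y \<in> B i. E v y})))" for i
  have "osc_le (avg (B i) f) v (b i)" if "i < N" for i
  proof (cases "v \<in> B i")
    case True
    then show ?thesis
      by (simp add: osc_le_def b_def avg_def recolorings_upd_inside)
  next
    case False
    have "osc_le (avg (B i) f) v (L * (weight v + real (card {y \<in> B i. E v y})))"
    proof (rule tree_attached_influence)
      show "osc_le f x (L * weight x)" if "x \<in> insert v (B i)" for x
        using that assms block_subset[OF \<open>i < N\<close>] by auto
      show "weight x + real (card {y \<in> B i. E x y}) \<le> real (k - \<Delta>)" if "x \<in> B i" for x
        using weight_plus_inner_degree[OF \<open>i < N\<close> that] colors by linarith
    qed (use False tree finite_block \<open>i < N\<close> assms(1) in auto)
    then show ?thesis using False by (simp add: b_def)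
  qed
  then have "osc_le (update f) v ((\<Sum>i<N. b i) / real N)"
    using osc_le_mean[of N "\<lambda>i. avg (B i) f" v b] by (simp add: update_def[abs_def])
  moreover have "(\<Sum>i<N. b i) / real N \<le> L * (1 - 1 / (real N * (real \<Delta> + 1))) * weight v"
  proof -
    have I: "{i. i < N \<and> v \<notin> B i} = {..<N} - {j}"
      using j block_unique by auto
    have "(\<Sum>i<N. b i) = (\<Sum>i\<in>{..<N} - {j}. b i)"
      using j by (simp add: sum.remove[of "{..<N}" j] b_def)
    also have "\<dots> = (\<Sum>i\<in>{..<N} - {j}. L * (weight v + real (card {y \<in> B i. E v y})))"
      using I by (intro sum.cong) (auto simp: b_def)
    also have "\<dots> = L * ((real N - 1) * weight v + (weight v - 1))"
      using j N_pos
      by (simp add: sum_distrib_left[symmetric] sum.distrib weight_def[of v] I of_nat_diff)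
    also have "\<dots> = L * (real N * weight v - 1)" by (simp add: algebra_simps)
    finally have "(\<Sum>i<N. b i) / real N = L * (weight v - 1 / real N)"
      using N_pos by (simp add: field_simps)
    \<comment> \<open>Since \<open>weight v \<le> \<Delta> + 1\<close>, the additive gain
      \<open>1 / N\<close> is at least the fraction \<open>1 / (N * (\<Delta> + 1))\<close> of the
      weight.\<close>
    also have "\<dots> \<le> L * (weight v - weight v / (real N * (real \<Delta> + 1)))"
    proof -
      have "weight v / (real N * (real \<Delta> + 1)) \<le> (real \<Delta> + 1) / (real N * (real \<Delta> + 1))"
        using weight_le[OF assms(3)] N_pos by (intro divide_right_mono) auto
      also have "\<dots> = 1 / real N"
        using of_nat_0_le_iff[of \<Delta>, where 'a = real] by (subst nonzero_divide_mult_cancel_right) auto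
      finally show ?thesis using assms(1) by (intro mult_left_mono) auto
    qed
    finally show ?thesis by (simp add: algebra_simps)
  qed
  ultimately show ?thesis unfolding osc_le_def using order_trans by blast
qed

lemma update_iterate_contracts:
  assumes "L \<ge> 0" "\<And>x. x \<in> V \<Longrightarrow> osc_le f x (L * weight x)" "v \<in> V"
  shows "osc_le ((update ^^ T) f) v (L * (1 - 1 / (real N * (real \<Delta> + 1))) ^ T * weight v)"
  using assms(3)
proof (induction T arbitrary: v)
  case 0
  then show ?case using assms by simp
next
  case (Suc T)
  \<comment> \<open>The contraction factor is nonnegative, so its power times \<open>L\<close> is
    again an admissible constant.\<close>
  have "real N * (real \<Delta> + 1) \<ge> 1 * 1" using N_pos by (intro mult_mono) auto
  then have "1 / (real N * (real \<Delta> + 1)) \<le> 1" by simp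
  then have "osc_le (update ((update ^^ T) f)) v
     (L * (1 - 1 / (real N * (real \<Delta> + 1))) ^ T * (1 - 1 / (real N * (real \<Delta> + 1))) * weight v)"
    using assms(1) Suc by (intro update_contracts) auto
  then show ?case by (simp add: mult_ac)
qed

section \<open>The chain on proper colorings\<close>

lemma finite_proper: "finite \<Omega>"
proof -
  have "\<Omega> \<subseteq> V \<rightarrow>\<^sub>E {..<k}" by (auto simp: proper_colorings_def)
  then show ?thesis using finite_V finite_subset finite_PiE by (metis finite_lessThan)
qed

text \<open>Extensional functions are \<open>undefined\<close> outside \<open>V\<close>, which
  supplies the base coloring. No edge leaves \<open>V\<close>, so these values constrain
  nothing.\<close>

lemma proper_eq_recolorings: "\<Omega> = recolorings V (\<lambda>_. undefined)"
proof -
  have "(\<forall>u v. E u v \<longrightarrow> \<sigma> u \<noteq> \<sigma> v) \<longleftrightarrow> (\<forall>u\<in>V. \<forall>v. E u v \<longrightarrow> \<sigma> u \<noteq> \<sigma> v)" for \<sigma> :: "nat \<Rightarrow> nat"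
    using edge_in_V by blast
  then show ?thesis
    unfolding proper_colorings_def recolorings_def PiE_iff extensional_def by auto
qed

lemma proper_nonempty: "\<Omega> \<noteq> {}"
  unfolding proper_eq_recolorings by (rule recolorings_nonempty[OF finite_V])

text \<open>Edges that avoid the block are already properly colored by \<open>\<sigma>\<close>, so
  it suffices to constrain the edges meeting it.\<close>

lemma recolorings_block:
  assumes "i < N" "\<sigma> \<in> \<Omega>"
  shows "recolorings (B i) \<sigma> = {\<tau> \<in> \<Omega>. \<forall>v\<in>V - B i. \<tau> v = \<sigma> v}"
proof (intro equalityI subsetI)
  fix \<tau> assume \<tau>: "\<tau> \<in> recolorings (B i) \<sigma>"
  have off: "\<tau> x = \<sigma> x" if "x \<notin> B i" for x using \<tau> that by (simp add: recolorings_def)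
  have "\<tau> x < k" if "x \<in> V" for x
    using \<tau> off[of x] assms(2) that
    by (cases "x \<in> B i") (auto simp: recolorings_def proper_eq_recolorings)
  moreover have "\<tau> x \<noteq> \<tau> y" if "E x y" for x y
  proof (cases "x \<in> B i \<or> y \<in> B i")
    case True
    then show ?thesis using \<tau> that E_sym[OF that] by (auto simp: recolorings_def) metis
  next
    case False
    then show ?thesis using off assms(2) that by (auto simp: proper_colorings_def)
  qed
  moreover have "\<tau> x = undefined" if "x \<notin> V" for x
    using off[of x] that block_subset[OF assms(1)] assms(2)
    by (auto simp: proper_eq_recolorings recolorings_def)
  ultimately show "\<tau> \<in> {\<tau> \<in> \<Omega>. \<forall>v\<in>V - B i. \<tau> v = \<sigma> v}"
    using off by (auto simp: proper_eq_recolorings recolorings_def)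
next
  fix \<tau> assume \<tau>: "\<tau> \<in> {\<tau> \<in> \<Omega>. \<forall>v\<in>V - B i. \<tau> v = \<sigma> v}"
  have "\<tau> x = \<sigma> x" if "x \<notin> B i" for x
    using \<tau> assms(2) that by (cases "x \<in> V") (auto simp: proper_eq_recolorings recolorings_def)
  then show "\<tau> \<in> recolorings (B i) \<sigma>"
    using \<tau> block_subset[OF assms(1)] by (auto simp: proper_eq_recolorings recolorings_def)
qed

lemma block_step_eq:
  assumes "\<sigma> \<in> \<Omega>"
  shows "block_step V E k N B \<sigma> =
    bind_pmf (pmf_of_set {..<N}) (\<lambda>i. pmf_of_set (recolorings (B i) \<sigma>))"
  unfolding block_step_def
proof (rule bind_pmf_cong[OF refl])
  fix i assume "i \<in> set_pmf (pmf_of_set {..<N})"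
  then have "i < N" using N_pos by (subst (asm) set_pmf_of_set) auto
  then show "pmf_of_set {\<tau> \<in> \<Omega>. \<forall>v\<in>V - B i. \<tau> v = \<sigma> v} = pmf_of_set (recolorings (B i) \<sigma>)"
    using recolorings_block[OF _ assms] by simp
qed

lemma set_pmf_recolorings:
  "i < N \<Longrightarrow> set_pmf (pmf_of_set (recolorings (B i) \<sigma>)) = recolorings (B i) \<sigma>"
  by (intro set_pmf_of_set recolorings_nonempty finite_recolorings finite_block)

lemma expectation_block_step:
  fixes f :: "(nat \<Rightarrow> nat) \<Rightarrow> real"
  assumes "\<sigma> \<in> \<Omega>"
  shows "measure_pmf.expectation (block_step V E k N B \<sigma>) f = update f \<sigma>"
proof -
  have "measure_pmf.expectation (block_step V E k N B \<sigma>) f =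
      (\<Sum>i<N. measure_pmf.expectation (pmf_of_set (recolorings (B i) \<sigma>)) f /\<^sub>R real (card {..<N}))"
    unfolding block_step_eq[OF assms]
    using N_pos by (intro pmf_expectation_bind_pmf_of_set)
      (auto simp: set_pmf_recolorings finite_recolorings finite_block)
  also have "\<dots> = (\<Sum>i<N. avg (B i) f \<sigma> / real N)"
  proof (intro sum.cong refl)
    fix i assume "i \<in> {..<N}"
    then have "measure_pmf.expectation (pmf_of_set (recolorings (B i) \<sigma>)) f = avg (B i) f \<sigma>"
      by (simp add: integral_pmf_of_set recolorings_nonempty finite_recolorings finite_block avg_def)
    then show "measure_pmf.expectation (pmf_of_set (recolorings (B i) \<sigma>)) f /\<^sub>R real (card {..<N}) =
        avg (B i) f \<sigma> / real N"
      by (simp add: divide_inverse mult.commute)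
  qed
  finally show ?thesis by (simp add: update_def sum_divide_distrib)
qed

lemma set_block_step:
  assumes "\<sigma> \<in> \<Omega>"
  shows "set_pmf (block_step V E k N B \<sigma>) \<subseteq> \<Omega>"
proof -
  have "set_pmf (pmf_of_set {..<N}) = {..<N}" using N_pos by (intro set_pmf_of_set) auto
  moreover have "recolorings (B i) \<sigma> \<subseteq> \<Omega>" if "i < N" for i
    unfolding recolorings_block[OF that assms] by blast
  ultimately show ?thesis
    unfolding block_step_eq[OF assms] by (auto simp: set_pmf_recolorings)
qed

section \<open>Several steps and the uniform distribution\<close>

lemma block_dist_Suc:
  "block_dist V E k N B (Suc T) \<sigma> = bind_pmf (block_dist V E k N B T \<sigma>) (block_step V E k N B)"
  by (simp add: block_dist_def)

lemma set_block_dist: "\<sigma> \<in> \<Omega> \<Longrightarrow> set_pmf (block_dist V E k N B T \<sigma>) \<subseteq> \<Omega>"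
proof (induction T)
  case 0
  then show ?case by (simp add: block_dist_def)
next
  case (Suc T)
  then show ?case using set_block_step by (auto simp: block_dist_Suc)
qed

text \<open>The last step of the chain is absorbed into the test function as
  \<open>update f\<close>; hence the induction is over all \<open>f\<close>.\<close>

lemma expectation_block_dist:
  fixes f :: "(nat \<Rightarrow> nat) \<Rightarrow> real"
  assumes "\<sigma> \<in> \<Omega>"
  shows "measure_pmf.expectation (block_dist V E k N B T \<sigma>) f = (update ^^ T) f \<sigma>"
proof (induction T arbitrary: f)
  case 0
  then show ?case by (simp add: block_dist_def)
next
  case (Suc T)
  let ?p = "block_dist V E k N B T \<sigma>"
  have "measure_pmf.expectation (block_dist V E k N B (Suc T) \<sigma>) f =
      (\<Sum>a\<in>\<Omega>. pmf ?p a *\<^sub>R measure_pmf.expectation (block_step V E k N B a) f)"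
    unfolding block_dist_Suc
    by (intro pmf_expectation_bind finite_proper set_block_dist[OF assms]
          finite_subset[OF set_block_step finite_proper])
  also have "\<dots> = (\<Sum>a\<in>\<Omega>. update f a * pmf ?p a)"
    by (intro sum.cong) (auto simp: expectation_block_step)
  also have "\<dots> = measure_pmf.expectation ?p (update f)"
    using finite_proper set_block_dist[OF assms]
    by (intro integral_measure_pmf_real[symmetric]) auto
  also have "\<dots> = (update ^^ T) (update f) \<sigma>" by (rule Suc.IH)
  finally show ?case by (simp add: funpow_swap1)
qed

text \<open>The uniform distribution is stationary under each block. Agreeing off \<open>B i\<close>
  is an equivalence relation on \<open>\<Omega>\<close>, and averaging over its classes preserves
  the total, by exchanging the two sums.\<close>

lemma sum_avg_block:
  assumes "i < N"
  shows "(\<Sum>\<sigma>\<in>\<Omega>. avg (B i) f \<sigma>) = sum f \<Omega>"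
proof -
  let ?R = "recolorings (B i)"
  have R: "{\<tau> \<in> \<Omega>. \<tau> \<in> ?R \<sigma>} = ?R \<sigma>" if "\<sigma> \<in> \<Omega>" for \<sigma>
    using recolorings_block[OF assms that] by auto
  have R_sym: "\<tau> \<in> ?R \<sigma> \<longleftrightarrow> \<sigma> \<in> ?R \<tau>" if "\<sigma> \<in> \<Omega>" "\<tau> \<in> \<Omega>" for \<sigma> \<tau>
    using that recolorings_block[OF assms] by auto
  have eq: "?R \<tau> = ?R \<sigma>" if "\<tau> \<in> ?R \<sigma>" "\<sigma> \<in> \<Omega>" "\<tau> \<in> \<Omega>" for \<sigma> \<tau>
    using that recolorings_block[OF assms] by auto
  have "(\<Sum>\<sigma>\<in>\<Omega>. avg (B i) f \<sigma>) = (\<Sum>\<sigma>\<in>\<Omega>. \<Sum>\<tau> | \<tau> \<in> \<Omega> \<and> \<tau> \<in> ?R \<sigma>. f \<tau> / real (card (?R \<tau>)))"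
  proof (intro sum.cong refl)
    fix \<sigma> assume \<sigma>: "\<sigma> \<in> \<Omega>"
    have "avg (B i) f \<sigma> = (\<Sum>\<tau>\<in>?R \<sigma>. f \<tau> / real (card (?R \<sigma>)))"
      by (simp add: avg_def sum_divide_distrib)
    also have "\<dots> = (\<Sum>\<tau> | \<tau> \<in> \<Omega> \<and> \<tau> \<in> ?R \<sigma>. f \<tau> / real (card (?R \<tau>)))"
      unfolding R[OF \<sigma>]
    proof (intro sum.cong refl)
      fix \<tau> assume "\<tau> \<in> ?R \<sigma>"
      then have "?R \<tau> = ?R \<sigma>" using eq[OF _ \<sigma>] R[OF \<sigma>] by blast
      then show "f \<tau> / real (card (?R \<sigma>)) = f \<tau> / real (card (?R \<tau>))" by simp
    qed
    finally show "avg (B i) f \<sigma> = (\<Sum>\<tau> | \<tau> \<in> \<Omega> \<and> \<tau> \<in> ?R \<sigma>. f \<tau> / real (card (?R \<tau>)))" .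
  qed
  also have "\<dots> = (\<Sum>\<tau>\<in>\<Omega>. \<Sum>\<sigma> | \<sigma> \<in> \<Omega> \<and> \<tau> \<in> ?R \<sigma>. f \<tau> / real (card (?R \<tau>)))"
    by (rule sum.swap_restrict[OF finite_proper finite_proper])
  also have "\<dots> = sum f \<Omega>"
  proof (intro sum.cong refl)
    fix \<tau> assume \<tau>: "\<tau> \<in> \<Omega>"
    have "{\<sigma>. \<sigma> \<in> \<Omega> \<and> \<tau> \<in> ?R \<sigma>} = ?R \<tau>" using R[OF \<tau>] R_sym[OF _ \<tau>] by blast
    then show "(\<Sum>\<sigma> | \<sigma> \<in> \<Omega> \<and> \<tau> \<in> ?R \<sigma>. f \<tau> / real (card (?R \<tau>))) = f \<tau>"
      using card_recolorings_pos[OF finite_block[OF assms], of \<tau>] by simp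
  qed
  finally show ?thesis .
qed

lemma sum_update: "sum (update f) \<Omega> = sum f \<Omega>"
proof -
  have "sum (update f) \<Omega> = (\<Sum>i<N. \<Sum>\<sigma>\<in>\<Omega>. avg (B i) f \<sigma>) / real N"
    unfolding update_def sum_divide_distrib[symmetric] by (subst sum.swap) simp
  then show ?thesis using N_pos by (simp add: sum_avg_block)
qed

lemma sum_update_iterate: "sum ((update ^^ T) f) \<Omega> = sum f \<Omega>"
  by (induction T) (simp_all add: sum_update)

text \<open>The chain from \<open>\<sigma>\<close> gives an event \<open>A\<close> the probability
  \<open>(update ^^ T) (indicator A) \<sigma>\<close>. By stationarity its uniform probability is
  the mean of the same function over \<open>\<Omega>\<close>, so it is enough to bound differences
  of this function between proper colorings.\<close>

lemma tv_dist_block_dist_le: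
  assumes "\<sigma> \<in> \<Omega>"
  shows "tv_dist (block_dist V E k N B T \<sigma>) (pmf_of_set \<Omega>) \<le>
    real (card V) * (real \<Delta> + 1) * (1 - 1 / (real N * (real \<Delta> + 1))) ^ T"
  unfolding tv_dist_def
proof (rule cSUP_least)
  fix A :: "(nat \<Rightarrow> nat) set"
  let ?f = "indicator A :: (nat \<Rightarrow> nat) \<Rightarrow> real"
  let ?r = "1 - 1 / (real N * (real \<Delta> + 1))"
  let ?h = "(update ^^ T) ?f"
  define D where "D = real (card V) * (real \<Delta> + 1) * ?r ^ T"
  have "real N * (real \<Delta> + 1) \<ge> 1 * 1" using N_pos by (intro mult_mono) auto
  then have r: "?r \<ge> 0" by simp
  \<comment> \<open>An indicator changes by at most one and weights are at least one, so the
    contraction starts from \<open>L = 1\<close>.\<close>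
  have osc0: "osc_le ?f x (1 * weight x)" for x
    unfolding osc_le_def using weight_ge_1[of x] by (auto simp: indicator_def)
  have close: "\<bar>?h \<sigma> - ?h \<tau>\<bar> \<le> D" if "\<tau> \<in> \<Omega>" for \<tau>
  proof -
    have "\<bar>?h \<sigma> - ?h \<tau>\<bar> \<le> (\<Sum>v\<in>V. 1 * ?r ^ T * weight v)"
    proof (rule osc_le_telescope[OF finite_V, where h = ?h and \<sigma> = \<sigma> and \<tau> = \<tau>])
      show "osc_le ?h v (1 * ?r ^ T * weight v)" if "v \<in> V" for v
        using osc0 that by (intro update_iterate_contracts) auto
      show "\<sigma> v = \<tau> v" if "v \<notin> V" for v
        using assms \<open>\<tau> \<in> \<Omega>\<close> that by (auto simp: proper_eq_recolorings recolorings_def)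
    qed
    also have "\<dots> \<le> (\<Sum>v\<in>V. 1 * ?r ^ T * (real \<Delta> + 1))"
      using r weight_le by (intro sum_mono mult_left_mono) auto
    finally show ?thesis by (simp add: D_def mult_ac)
  qed
  define n where "n = real (card \<Omega>)"
  have n: "n > 0" using finite_proper proper_nonempty by (simp add: n_def card_gt_0_iff)
  have "measure_pmf.prob (block_dist V E k N B T \<sigma>) A = ?h \<sigma>"
    using expectation_block_dist[OF assms, of T ?f] by simp
  moreover have "measure_pmf.prob (pmf_of_set \<Omega>) A = sum ?h \<Omega> / n"
    using integral_pmf_of_set[OF proper_nonempty finite_proper, of ?f] sum_update_iterate[of T ?f]
    by (simp add: n_def)
  ultimately have "measure_pmf.prob (block_dist V E k N B T \<sigma>) A - measure_pmf.prob (pmf_of_set \<Omega>) A =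
      (\<Sum>\<tau>\<in>\<Omega>. ?h \<sigma> - ?h \<tau>) / n"
    using n by (simp add: sum_subtractf n_def[symmetric] diff_divide_distrib)
  moreover have "\<bar>\<Sum>\<tau>\<in>\<Omega>. ?h \<sigma> - ?h \<tau>\<bar> \<le> (\<Sum>\<tau>\<in>\<Omega>. D)"
    using close by (intro order_trans[OF sum_abs] sum_mono)
  then have "\<bar>\<Sum>\<tau>\<in>\<Omega>. ?h \<sigma> - ?h \<tau>\<bar> \<le> D * n" by (simp add: n_def mult.commute)
  ultimately show "\<bar>measure_pmf.prob (block_dist V E k N B T \<sigma>) A - measure_pmf.prob (pmf_of_set \<Omega>) A\<bar> \<le>
      real (card V) * (real \<Delta> + 1) * ?r ^ T"
    using n by (simp add: abs_divide pos_divide_le_eq flip: D_def)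
qed simp

text \<open>With \<open>n = card V\<close> and \<open>d = \<Delta> + 1\<close>, the distance is at
  most \<open>n * d * exp (- T / (N * d))\<close>. As \<open>N \<le> n\<close>, the assumed
  \<open>T\<close> makes the exponential at most \<open>1 / (4 * n * d)\<close>.\<close>

lemma mixing_time_le:
  assumes "real T \<ge> real (card V) * (real \<Delta> + 1) * ln (4 * real (card V) * (real \<Delta> + 1))"
  shows "mixing_time V E k N B \<le> T"
  unfolding mixing_time_def
proof (intro Least_le ballI)
  fix \<sigma> assume \<sigma>: "\<sigma> \<in> \<Omega>"
  define n d where "n = real (card V)" and "d = real \<Delta> + 1"
  have n: "n \<ge> 1" and d: "d \<ge> 1"
    using finite_V V_nonempty by (auto simp: n_def d_def Suc_le_eq card_gt_0_iff)
  have N: "0 < real N * d" "real N * d \<le> n * d"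
    using N_pos N_le_card d by (auto simp: n_def)
  have nd: "1 \<le> n * d" using mult_mono[of 1 n 1 d] n d by simp
  have "ln (4 * n * d) \<le> real T / (n * d)"
    using assms nd n d by (simp add: n_def[symmetric] d_def[symmetric] pos_le_divide_eq mult_ac)
  also have "\<dots> \<le> real T / (real N * d)"
    using N by (intro divide_left_mono) auto
  finally have "exp (- (real T / (real N * d))) \<le> exp (- ln (4 * n * d))" by simp
  also have "\<dots> = 1 / (4 * n * d)" using nd n d by (simp add: exp_minus inverse_eq_divide)
  finally have e: "exp (- (real T / (real N * d))) \<le> 1 / (4 * n * d)" .
  have "1 * 1 \<le> real N * d" using N_pos d by (intro mult_mono) auto
  then have "(1 - 1 / (real N * d)) ^ T \<le> exp (- (1 / (real N * d))) ^ T"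
    using exp_ge_add_one_self[of "- (1 / (real N * d))"] by (intro power_mono) auto
  also have "\<dots> = exp (- (real T / (real N * d)))"
    by (simp add: exp_of_nat_mult[symmetric])
  finally have "n * d * (1 - 1 / (real N * d)) ^ T \<le> n * d * (1 / (4 * n * d))"
    using e nd by (intro mult_left_mono) auto
  also have "\<dots> = 1 / 4" using n d by simp
  finally show "tv_dist (block_dist V E k N B T \<sigma>) (pmf_of_set \<Omega>) \<le> 1 / 4"
    using tv_dist_block_dist_le[OF \<sigma>, of T] by (simp add: n_def d_def)
qed

end

section \<open>The girth condition\<close>

text \<open>The infimum defining the distance is attained: a finite distance requires some walk, and
  \<open>enat\<close> is well-ordered. Lists count vertices rather than edges, hence the
  \<open>+ 1\<close>.\<close>

lemma diameter_finite_walk: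
  assumes "diameter E B \<noteq> \<infinity>" "u \<in> B" "v \<in> B"
  shows "\<exists>xs. xs \<noteq> [] \<and> successively E xs \<and> hd xs = u \<and> last xs = v \<and>
           length xs \<le> the_enat (diameter E B) + 1"
proof -
  let ?W = "{xs. is_walk E xs \<and> hd xs = u \<and> last xs = v}"
  have "gdist E u v \<le> (SUP v\<in>B. gdist E u v)" using assms(3) by (rule SUP_upper)
  also have "\<dots> \<le> diameter E B"
    unfolding diameter_def using assms(2) by (rule SUP_upper)
  finally have le: "gdist E u v \<le> enat (the_enat (diameter E B))" using assms(1) by (cases "diameter E B") auto
  have "?W \<noteq> {}"
  proof
    assume "?W = {}"
    then have "gdist E u v = \<infinity>" unfolding gdist_def by (simp only:) (simp add: top_enat_def)
    then show False using le by simp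
  qed
  then obtain ys where "ys \<in> ?W" by blast
  then have "gdist E u v \<in> (\<lambda>xs. enat (length xs - 1)) ` ?W"
    unfolding gdist_def by (intro wellorder_InfI[OF imageI])
  then obtain xs where xs: "xs \<in> ?W" "gdist E u v = enat (length xs - 1)" by blast
  then have "length xs \<le> the_enat (diameter E B) + 1" using le by simp
  then show ?thesis using xs(1) by (auto simp: is_walk_def successively_conv_nth)
qed

text \<open>If \<open>v\<close> has a neighbor in \<open>B\<close>, adding \<open>v\<close> raises
  distances by at most one. With \<open>d\<close> the diameter, cycles inside
  \<open>insert v B\<close> are then excluded once all cycles exceed \<open>2 * (d + 1) + 1\<close>
  in length, and the girth is at least \<open>2 * d + 6\<close>.\<close>

lemma girth_imp_tree_attached:
  assumes "simple_graph V E" "girth E \<ge> enat g" "finite B" "v \<notin> B"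
    and "diameter E B \<noteq> \<infinity>" "2 * the_enat (diameter E B) + 6 \<le> g"
  shows "tree_attached E v B"
proof (cases "\<exists>u\<in>B. E v u")
  case False
  then show ?thesis by (intro tree_attached.isolated) auto
next
  case True
  then obtain u where u: "u \<in> B" "E v u" by blast
  let ?d = "the_enat (diameter E B)"
  have E: "symp E" "\<And>v. \<not> E v v"
    using assms(1) by (auto simp: simple_graph_def symp_def)
  have long: "length ys > 2 * (?d + 1) + 1" if "is_cycle E ys" for ys
  proof -
    have "girth E \<le> enat (length ys)"
      unfolding girth_def using that by (intro INF_lower) simp
    then have "enat g \<le> enat (length ys)" using assms(2) by (rule order_trans[rotated])
    then show ?thesis using assms(6) by simp
  qed
  note walk = diameter_finite_walk[OF assms(5)]
  have "\<exists>xs. xs \<noteq> [] \<and> successively E xs \<and> hd xs = a \<and> last xs = b \<and> length xs \<le> (?d + 1) + 1"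
    if ab: "a \<in> insert v B" "b \<in> insert v B" for a b
  proof -
    consider "a = v" "b = v" | "a = v" "b \<in> B" | "a \<in> B" "b = v" | "a \<in> B" "b \<in> B"
      using ab by blast
    then show ?thesis
    proof cases
      case 1
      then show ?thesis by (intro exI[of _ "[v]"]) auto
    next
      case 2
      obtain xs where "xs \<noteq> []" "successively E xs" "hd xs = u" "last xs = b" "length xs \<le> ?d + 1"
        using walk[OF u(1) 2(2)] by blast
      then show ?thesis using 2 u(2)
        by (intro exI[of _ "v # xs"]) (auto simp: successively_Cons)
    next
      case 3
      obtain xs where "xs \<noteq> []" "successively E xs" "hd xs = a" "last xs = u" "length xs \<le> ?d + 1"
        using walk[OF 3(1) u(1)] by blast
      then show ?thesis using 3 sympD[OF E(1) u(2)]
        by (intro exI[of _ "xs @ [v]"]) (auto simp: successively_append_iff)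
    next
      case 4
      then show ?thesis using walk[of a b] by fastforce
    qed
  qed
  then have "\<not> is_cycle E xs" if "set xs \<subseteq> insert v B" for xs
    using no_cycle_in_small_diameter_set[OF E long, where W = "insert v B"] that by blast
  then show ?thesis using acyclic_imp_tree_attached[OF E(1) assms(3,4)] by blast
qed

text \<open>The constant is \<open>9 = 8 + 1\<close>: the bounds \<open>d + 1 \<le> 2 * d\<close>
  and \<open>4 * n * (d + 1) \<le> n ^ 4\<close> give eight, and the summand \<open>1\<close> from
  rounding up costs one more because \<open>ln 2 \<ge> 1 / 2\<close>.\<close>

lemma mixing_time_bound_arith:
  fixes n d :: real
  assumes "n \<ge> 2" "d \<ge> 1" "d + 1 \<le> n"
  shows "n * (d + 1) * ln (4 * n * (d + 1)) + 1 \<le> 9 * d * n * ln n"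
proof -
  have "4 * n * (d + 1) \<le> (n * n) * n * n"
    using assms mult_mono[of 2 n 2 n] by (intro mult_mono) auto
  also have "\<dots> = n ^ 4" by (simp add: power4_eq_xxxx)
  finally have "ln (4 * n * (d + 1)) \<le> ln (n ^ 4)"
    using assms by (subst ln_le_cancel_iff) auto
  then have ln: "ln (4 * n * (d + 1)) \<le> 4 * ln n" using assms by (simp add: ln_realpow)
  have "n * (d + 1) * ln (4 * n * (d + 1)) \<le> n * (2 * d) * (4 * ln n)"
    using assms ln by (intro mult_mono) (auto intro!: ln_ge_zero mult_mono simp: mult_ge1_I)
  moreover have "1 \<le> d * n * ln n"
  proof -
    have "ln n \<ge> ln 2" using assms by simp
    moreover have "ln 2 \<ge> (1 / 2 :: real)" using ln_le_minus_one[of "1 / 2"] by (simp add: ln_div)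
    ultimately have "ln n \<ge> 1 / 2" by linarith
    then have "1 * 2 * (1 / 2) \<le> d * n * ln n" using assms by (intro mult_mono) auto
    then show ?thesis by simp
  qed
  ultimately show ?thesis by (simp add: algebra_simps)
qed

text \<open>An edge is assumed because an edgeless graph has \<open>\<Delta> = 0\<close>, which
  would make the bound zero. Finiteness of the diameters is stated separately because
  \<open>the_enat\<close> says nothing about infinity.\<close>

theorem theorem3p1:
  "\<exists>C>0. \<forall>(g::nat) V E (\<Delta>::nat) (k::nat) (N::nat) B.
     g \<ge> 3 \<longrightarrow> simple_graph V E \<longrightarrow> (\<exists>u v. E u v) \<longrightarrow>
     girth E \<ge> enat g \<longrightarrow> \<Delta> = max_degree V E \<longrightarrow> k > 2 * \<Delta> \<longrightarrow>
     block_partition V N B \<longrightarrow>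
     (\<forall>i<N. diameter E (B i) \<noteq> \<infinity> \<and>
            real (the_enat (diameter E (B i))) \<le> real g / 2 - 3) \<longrightarrow>
     real (mixing_time V E k N B) \<le> C * real \<Delta> * real (card V) * ln (real (card V))"
proof (intro exI[of _ 9] conjI allI impI)
  fix g :: nat and V E and \<Delta> k N :: nat and B
  assume G: "simple_graph V E" and "\<exists>u v. E u v" and girth: "girth E \<ge> enat g"
    and \<Delta>: "\<Delta> = max_degree V E" and k: "k > 2 * \<Delta>" and part: "block_partition V N B"
    and diam: "\<forall>i<N. diameter E (B i) \<noteq> \<infinity> \<and> real (the_enat (diameter E (B i))) \<le> real g / 2 - 3"
  obtain u v where uv: "E u v" using \<open>\<exists>u v. E u v\<close> by blast
  have fin: "finite V" and inV: "\<And>u v. E u v \<Longrightarrow> u \<in> V \<and> v \<in> V" and irr: "\<And>v. \<not> E v v"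
    and sym: "symp E"
    using G by (auto simp: simple_graph_def symp_def)
  have nbrs: "{y. E x y} \<subseteq> V" for x using inV by auto
  have fn: "finite {y. E x y}" for x using nbrs fin finite_subset by blast
  have deg: "card {y. E x y} \<le> \<Delta>" for x
  proof (cases "x \<in> V")
    case True
    then show ?thesis unfolding \<Delta> max_degree_def degree_def using fin by (intro Max_ge) auto
  next
    case False
    then have "{y. E x y} = {}" using inV by auto
    then show ?thesis by simp
  qed
  have \<Delta>1: "\<Delta> \<ge> 1"
    using deg[of u] fn[of u] uv by (metis card_0_eq empty_iff mem_Collect_eq not_less_eq_eq le_zero_eq One_nat_def)
  have "\<Delta> \<in> degree E ` V"
    unfolding \<Delta> max_degree_def using fin inV[OF uv] by (intro Max_in) auto
  then obtain x where x: "x \<in> V" "\<Delta> = card {y. E x y}" by (auto simp: degree_def)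
  \<comment> \<open>A vertex of maximum degree has all its neighbors among the other vertices, so
    \<open>\<Delta> + 1 \<le> card V\<close>.\<close>
  have "card {y. E x y} \<le> card (V - {x})"
    using nbrs irr fin by (intro card_mono) auto
  moreover have "card V > 0" using fin x(1) by (auto simp: card_gt_0_iff)
  ultimately have n: "\<Delta> + 1 \<le> card V" using x fin by simp
  interpret block_coloring E k \<Delta> V N B
  proof
    show "tree_attached E v (B i)" if "i < N" "v \<notin> B i" for i v
    proof (rule girth_imp_tree_attached[OF G girth])
      show "finite (B i)" using part fin that(1) by (auto simp: block_partition_def intro: finite_subset)
      have "2 * real (the_enat (diameter E (B i))) + 6 \<le> real g" using diam that(1) by fastforce
      then show "2 * the_enat (diameter E (B i)) + 6 \<le> g" by linarith
    qed (use diam that in auto)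
  qed (use sym irr fn deg k fin inV part uv in auto)
  define T where "T = nat \<lceil>real (card V) * (real \<Delta> + 1) * ln (4 * real (card V) * (real \<Delta> + 1))\<rceil>"
  have "mixing_time V E k N B \<le> T"
    by (rule mixing_time_le) (simp add: T_def real_nat_ceiling_ge)
  moreover have "real T \<le> real (card V) * (real \<Delta> + 1) * ln (4 * real (card V) * (real \<Delta> + 1)) + 1"
  proof -
    \<comment> \<open>Nonnegativity ensures that \<open>nat\<close> does not cut off a negative
      ceiling, so rounding adds at most one.\<close>
    have "0 \<le> ln (4 * real (card V) * (real \<Delta> + 1))"
      using n by (intro ln_ge_zero) (simp add: mult_ge1_I)
    then have "0 \<le> real (card V) * (real \<Delta> + 1) * ln (4 * real (card V) * (real \<Delta> + 1))" by simp
    then show ?thesis unfolding T_def by linarith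
  qed
  moreover have "\<dots> \<le> 9 * real \<Delta> * real (card V) * ln (real (card V))"
    using n \<Delta>1 by (intro mixing_time_bound_arith) auto
  ultimately show "real (mixing_time V E k N B) \<le> 9 * real \<Delta> * real (card V) * ln (real (card V))"
    by linarith
qed simp

end
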